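(* Let $N$ be a positive integer and let $m$ be a positive divisor of $\lambda(N)$. Define $$\sigma=\Bigg(\prod_{\substack{p\mid\gcd\{m,s_N\}\\ \gcd\{p-1,m\}\leq2}}p^{\max\{1,\min\{v_p(m),\,v_p(2N)-v_p(m)\}\}}\Bigg)\cdot2^{\varepsilon-\min\{\theta,v_2(s_N)\}},$$ where the product is over primes $p$, $\theta$ is $1$ if $2v_2(m)=v_2(N)+1$ and $0$ otherwise, and $\varepsilon$ equals $2$ if $v_2(m)\geq v_2(N)\geq6$, equals $1$ if $v_2(m)=v_2(N)-1\geq5$ or if $v_2(m)\geq v_2(N)$ with $v_2(N)\in\{4,5\}$, and equals $0$ otherwise. Then the normalizer of $\Gamma_1^{[m]}(N)$ in $SL_2(\mathbb{R})$ is precisely $\Gamma_0^{*,\sigma}(N)$.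
   Context: For a positive integer $M$, write uniquely $M=s_M^2t_M$ with $s_M,t_M$ positive integers and $t_M$ square-free; $v_p(M)$ is the $p$-adic valuation of $M$. A positive divisor $\mu$ of $N$ is exact if $\gcd(\mu,N/\mu)=1$. $\Gamma_0^{*,s_N}(N)$ is the set of $A\in SL_2(\mathbb{R})$ admitting a presentation $A=\begin{pmatrix} a\sqrt{\mu} & b/\sqrt{\mu}\\ c\frac{N}{\mu}\sqrt{\mu} & d\sqrt{\mu}\end{pmatrix}$ with $\mu$ an exact divisor of $N$, $a,d\in\frac{1}{s_\mu}\mathbb{Z}$ and $b,c\in\frac{1}{s_{N/\mu}}\mathbb{Z}$. A presentation is cancelation-free if in each of the products $ab,ac,bd,cd$ of rational numbers in lowest terms no cancelation occurs (the denominator of the product is the product of the denominators); every element of $\Gamma_0^{*,s_N}(N)$ has such a presentation. For a positive divisor $\sigma$ of $s_N$, $\Gamma_0^{*,\sigma}(N)$ is the set of $A\in\Gamma_0^{*,s_N}(N)$ such that in a cancelation-free presentation $a,b,c,d\in\frac{1}{\sigma}\mathbb{Z}$ (equivalently, $\sigma ab,\sigma cd\in\mathbb{Z}$ in any presentation). $\Gamma_0(N)$ is the group of matrices in $SL_2(\mathbb{Z})$ with lower left entry divisible by $N$. $\lambda(N)$ is the exponent of $(\mathbb{Z}/N\mathbb{Z})^\times$ (Carmichael's function). $\Gamma_1^{[m]}(N)$ is the group of matrices in $\Gamma_0(N)$ whose diagonal entries, reduced modulo $N$, lie in the $m$-torsion subgroup $(\mathbb{Z}/N\mathbb{Z})^\times[m]=\{x:x^m=1\}$.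 *)

theory Defs
  imports
    "HOL-Analysis.Analysis"
    "HOL-Algebra.Group_Action"
    "HOL-Computational_Algebra.Squarefree"
    "HOL-Number_Theory.Residue_Primitive_Roots"
begin

definition mat2 :: "real \<Rightarrow> real \<Rightarrow> real \<Rightarrow> real \<Rightarrow> real^2^2" where
  "mat2 a b c d = vector [vector [a, b], vector [c, d]]"

definition SL2R :: "(real^2^2) monoid" where
  "SL2R = \<lparr>carrier = {A. det A = 1}, monoid.mult = (**), one = mat 1\<rparr>"

lemma group_SL2R: "group SL2R"
proof (rule groupI)
  fix A assume A: "A \<in> carrier SL2R"
  then have "invertible A"
    by (simp add: SL2R_def invertible_det_nz)
  then obtain B where B: "B ** A = mat 1"
    by (auto simp: invertible_def)
  then have "det B * det A = 1"
    by (metis det_I det_mul)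
  with A B show "\<exists>B\<in>carrier SL2R. B \<otimes>\<^bsub>SL2R\<^esub> A = \<one>\<^bsub>SL2R\<^esub>"
    by (auto simp: SL2R_def)
qed (auto simp: SL2R_def det_mul matrix_mul_assoc)

definition Gamma0 :: "nat \<Rightarrow> (real^2^2) set" where
  "Gamma0 N = {mat2 (of_int a) (of_int b) (of_int c) (of_int d) | a b c d :: int.
     a * d - b * c = 1 \<and> int N dvd c}"

text \<open>Integer representatives of the \<open>m\<close>-torsion subgroup of the unit group of \<open>\<int>/N\<int>\<close>.\<close>

definition unit_torsion :: "nat \<Rightarrow> nat \<Rightarrow> int set" where
  "unit_torsion m N = {x. coprime x (int N) \<and> [x ^ m = 1] (mod int N)}"

definition Gamma1_torsion :: "nat \<Rightarrow> nat \<Rightarrow> (real^2^2) set" where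
  "Gamma1_torsion m N = {A \<in> Gamma0 N.
     \<exists>a d :: int. A $ 1 $ 1 = of_int a \<and> A $ 2 $ 2 = of_int d \<and>
       a \<in> unit_torsion m N \<and> d \<in> unit_torsion m N}"

text \<open>
  If \<open>M = s\<^sup>2 t\<close> with \<open>t\<close> square-free, then \<open>s\<close> is the library's \<^term>\<open>square_part M\<close>
  (see \<open>squarefree_decompose\<close>).
\<close>

definition frac_ints :: "nat \<Rightarrow> rat set" where
  "frac_ints s = {of_int k / of_nat s | k :: int. True}"

definition exact_divisor :: "nat \<Rightarrow> nat \<Rightarrow> bool" where
  "exact_divisor \<mu> N \<longleftrightarrow> \<mu> dvd N \<and> coprime \<mu> (N div \<mu>)"

definition presentation ::
    "nat \<Rightarrow> nat \<Rightarrow> rat \<Rightarrow> rat \<Rightarrow> rat \<Rightarrow> rat \<Rightarrow> real^2^2 \<Rightarrow> bool" where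
  "presentation N \<mu> a b c d A \<longleftrightarrow>
     exact_divisor \<mu> N \<and>
     a \<in> frac_ints (square_part \<mu>) \<and> d \<in> frac_ints (square_part \<mu>) \<and>
     b \<in> frac_ints (square_part (N div \<mu>)) \<and> c \<in> frac_ints (square_part (N div \<mu>)) \<and>
     A = mat2 (of_rat a * sqrt \<mu>) (of_rat b / sqrt \<mu>)
              (of_rat c * real (N div \<mu>) * sqrt \<mu>) (of_rat d * sqrt \<mu>)"

definition Gamma0_star_full :: "nat \<Rightarrow> (real^2^2) set" where
  "Gamma0_star_full N = {A \<in> carrier SL2R. \<exists>\<mu> a b c d. presentation N \<mu> a b c d A}"

text \<open>The denominator in lowest terms; it is positive, and \<open>0\<close> has denominator \<open>1\<close>.\<close>

definition denom :: "rat \<Rightarrow> int" where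
  "denom q = snd (quotient_of q)"

definition no_cancel :: "rat \<Rightarrow> rat \<Rightarrow> bool" where
  "no_cancel x y \<longleftrightarrow> denom (x * y) = denom x * denom y"

definition cancelation_free :: "rat \<Rightarrow> rat \<Rightarrow> rat \<Rightarrow> rat \<Rightarrow> bool" where
  "cancelation_free a b c d \<longleftrightarrow>
     no_cancel a b \<and> no_cancel a c \<and> no_cancel b d \<and> no_cancel c d"

definition Gamma0_star :: "nat \<Rightarrow> nat \<Rightarrow> (real^2^2) set" where
  "Gamma0_star \<sigma> N = {A \<in> Gamma0_star_full N.
     \<exists>\<mu> a b c d. presentation N \<mu> a b c d A \<and> cancelation_free a b c d \<and>
       {a, b, c, d} \<subseteq> frac_ints \<sigma>}"

definition theta :: "nat \<Rightarrow> nat \<Rightarrow> nat" where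
  "theta N m = (if 2 * multiplicity 2 m = multiplicity 2 N + 1 then 1 else 0)"

definition epsilon :: "nat \<Rightarrow> nat \<Rightarrow> nat" where
  "epsilon N m =
     (let v = multiplicity 2 m; n = multiplicity 2 N in
      if v \<ge> n \<and> n \<ge> 6 then 2
      else if (v + 1 = n \<and> v \<ge> 5) \<or> (v \<ge> n \<and> n \<in> {4, 5}) then 1
      else 0)"

text \<open>
  The exponent of \<open>2\<close> at the end may be negative, and so may the second argument of the
  minimum; hence integer exponents and a rational value.
\<close>

definition sigma_level :: "nat \<Rightarrow> nat \<Rightarrow> rat" where
  "sigma_level N m =
     (\<Prod>p | prime p \<and> p dvd gcd m (square_part N) \<and> gcd (p - 1) m \<le> 2.
        of_nat p powi
          max 1 (min (int (multiplicity p m))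
                     (int (multiplicity p (2 * N)) - int (multiplicity p m))))
     * 2 powi (int (epsilon N m) - int (min (theta N m) (multiplicity 2 (square_part N))))"

end

(*
  Write N = s^2 u with u square-free. Testing the two unipotent elements of Gamma_1^[m](N) shows that an
  element A of its normalizer has integral alpha^2, delta^2, N beta^2, gamma^2/N, alpha gamma,
  gamma delta and N alpha beta; so A is sqrt(t) times a rational matrix with t | u, and in fact alpha = x sqrt t, beta = y/(s sqrt t),
  gamma = z s t' sqrt t, delta = w sqrt t with integers x, y, z, w and u = t t'. Conversely, such an A
  normalizes the group iff for all torsion units e with inverse h modulo N the integer s divides
  xy(h - e) and zw(h - e), and the upper left entry of the conjugate is again a torsion unit.
  These conditions can be checked one prime p at a time. At p they ask for s | sigma xy and s | sigma zw,
  where the exponent of sigma at p is governed by two numbers: how close to 1 the squares e^2 of torsion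
  units are forced to be, and how deep an element 1 + p^i X must lie to be m-torsion (lifting the exponent).
*)

theory Submission
  imports Defs
begin

section \<open>Lifting the exponent\<close>

text \<open>Write n and v for the exponents of p in N and m, l for that of sigma, and k = n div 2
  for that of s. Two demands on l compete. Squares of torsion units must be 1 modulo p^l, so that
  p^(k - l) dividing xy already makes p^k divide xy(h - e). And the diagonal of the conjugate, which
  changes by multiples of e^2 - 1 and of p^(n - l), must stay torsion. If gcd (p - 1) m > 2, the
  first demand fails for every l > 0; if p does not divide m, the second does. At the other odd
  primes R = max (n - v) 1 governs both: the demands read l <= R and R <= n - l, and the best choice
  is min v R. At 2, torsion units and their squares drift apart: an odd square is 1 modulo 8 even
  when all odd numbers are torsion, and squaring 1 + 2^i with i >= 2 brings it one step closer to 1.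
  This is the origin of 2N in the minimum and of the corrections by epsilon, while theta reflects
  that l cannot exceed k.\<close>

lemma not_dvd_geometric_sum:
  fixes a :: int and p m :: nat
  assumes "int p dvd a - 1" "\<not> p dvd m"
  shows "\<not> int p dvd (\<Sum>i<m. a ^ i)"
proof -
  have "[(\<Sum>i<m. a ^ i) = (\<Sum>i<m. 1 ^ i)] (mod int p)"
    using assms(1) by (intro cong_sum cong_pow) (simp add: cong_iff_dvd_diff)
  then have "[(\<Sum>i<m. a ^ i) = int m] (mod int p)" by simp
  then show ?thesis using assms(2) by (simp add: cong_dvd_iff)
qed

text \<open>With a = 1 + pb the sum is p + pb * p(p - 1)/2 modulo p^2, and the second term vanishes
  because p - 1 is even. For p = 2 the sum is a + 1, and it takes a = 1 modulo 4 to make this 2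
  modulo 4.\<close>

lemma geometric_sum_prime:
  fixes a :: int and p :: nat
  assumes p: "prime p" and a: "int p dvd a - 1" and two: "p = 2 \<Longrightarrow> 4 dvd a - 1"
  shows "\<exists>c. (\<Sum>i<p. a ^ i) = int p * c \<and> \<not> int p dvd c"
proof -
  obtain b where b: "a = 1 + int p * b" using a by (metis dvd_def add.commute diff_add_cancel)
  have p1: "p > 1" using p prime_gt_1_nat by blast
  have "[(\<Sum>i<p. a ^ i) = int p] (mod (int p)^2)"
  proof (cases "p = 2")
    case True
    then have "(\<Sum>i<p. a ^ i) = a + 1" by (simp add: numeral_2_eq_2)
    then show ?thesis using two True by (simp add: cong_iff_dvd_diff)
  next
    case False
    then have "odd p" using p primes_dvd_imp_eq two_is_prime_nat by blast
    have *: "[a ^ i = 1 + int i * int p * b] (mod (int p)^2)" for i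
    proof (induction i)
      case (Suc i)
      have "[a ^ i * a = (1 + int i * int p * b) * (1 + int p * b)] (mod (int p)^2)"
        using Suc b by (intro cong_mult) auto
      also have "(1 + int i * int p * b) * (1 + int p * b)
         = 1 + int (Suc i) * int p * b + (int p)^2 * (int i * b^2)"
        by (simp add: algebra_simps power2_eq_square)
      also have "[\<dots> = 1 + int (Suc i) * int p * b] (mod (int p)^2)"
        by (simp add: cong_iff_dvd_diff)
      finally show ?case by (simp add: mult.commute)
    qed simp
    have "[(\<Sum>i<p. a ^ i) = (\<Sum>i<p. 1 + int i * int p * b)] (mod (int p)^2)"
      by (intro cong_sum *)
    also have "(\<Sum>i<p. 1 + int i * int p * b) = int p + int p * b * (\<Sum>i<p. int i)"
      by (simp add: sum.distrib sum_distrib_left sum_distrib_right algebra_simps)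
    also have "(\<Sum>i<p. int i) = int p * int ((p - 1) div 2)"
    proof -
      have "2 * (\<Sum>i<p. int i) = int p * (int p - 1)" by (induction p) (auto simp: algebra_simps)
      moreover have "int p - 1 = 2 * int ((p - 1) div 2)" using \<open>odd p\<close> p1
        by (auto elim!: oddE)
      ultimately show ?thesis by simp
    qed
    also have "[int p + int p * b * (int p * int ((p - 1) div 2)) = int p] (mod (int p)^2)"
      by (simp add: cong_iff_dvd_diff power2_eq_square mult_ac)
    finally show ?thesis .
  qed
  then obtain d where "(\<Sum>i<p. a ^ i) = int p + (int p)^2 * d"
    by (metis cong_iff_lin cong_sym)
  then have "(\<Sum>i<p. a ^ i) = int p * (1 + int p * d)"
    by (simp add: algebra_simps power2_eq_square)
  moreover have "\<not> int p dvd 1 + int p * d"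
    using p1 by (simp add: dvd_add_left_iff)
  ultimately show ?thesis by blast
qed

text \<open>Each p-th power adds exactly one factor p, and the part of m prime to p contributes a
  geometric sum prime to p. A cofactor \<open>c\<close> is used instead of valuations so that a = 1,
  where both sides vanish, is no exception.\<close>

lemma lifting_the_exponent:
  fixes a :: int and p m :: nat
  assumes p: "prime p" and a: "int p dvd a - 1" and two: "p = 2 \<Longrightarrow> 4 dvd a - 1" and m: "m > 0"
  shows "\<exists>c. a ^ m - 1 = (a - 1) * int p ^ multiplicity p m * c \<and> \<not> int p dvd c"
proof -
  have pp: "prime (int p)" using p by simp
  have pow: "int p dvd a ^ i - 1" "p = 2 \<Longrightarrow> 4 dvd a ^ i - 1" for i
  proof -
    have "a - 1 dvd a ^ i - 1" by (metis dvd_triv_left power_diff_1_eq)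
    then show "int p dvd a ^ i - 1" "p = 2 \<Longrightarrow> 4 dvd a ^ i - 1"
      using a two dvd_trans by blast+
  qed
  have *: "\<exists>c. a ^ (p ^ v) - 1 = (a - 1) * int p ^ v * c \<and> \<not> int p dvd c" for v
  proof (induction v)
    case 0
    then show ?case using p by (intro exI[of _ 1]) auto
  next
    case (Suc v)
    then obtain c where c: "a ^ (p ^ v) - 1 = (a - 1) * int p ^ v * c" "\<not> int p dvd c" by blast
    obtain d where d: "(\<Sum>i<p. (a ^ (p ^ v)) ^ i) = int p * d" "\<not> int p dvd d"
      using geometric_sum_prime[OF p pow] by blast
    have "a ^ (p ^ Suc v) - 1 = (a ^ (p ^ v)) ^ p - 1"
      by (metis power_Suc2 power_mult)
    also have "\<dots> = (a ^ (p ^ v) - 1) * (int p * d)"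
      by (simp only: power_diff_1_eq d)
    also have "\<dots> = (a - 1) * int p ^ Suc v * (c * d)" by (simp only: c(1) power_Suc mult_ac)
    finally show ?case using c d pp by (intro exI[of _ "c * d"]) (auto simp: prime_dvd_mult_iff)
  qed
  define v where "v = multiplicity p m"
  obtain q where q: "m = p ^ v * q" "\<not> p dvd q"
    using multiplicity_decompose'[of m p] m p unfolding v_def by (metis not_prime_unit not_gr0)
  obtain c where c: "a ^ (p ^ v) - 1 = (a - 1) * int p ^ v * c" "\<not> int p dvd c" using * by blast
  have "a ^ m - 1 = (a ^ (p ^ v)) ^ q - 1" by (simp add: q power_mult)
  also have "\<dots> = (a - 1) * int p ^ v * (c * (\<Sum>i<q. (a ^ (p ^ v)) ^ i))"
    by (simp only: power_diff_1_eq[of _ q] c(1) mult.assoc)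
  finally show ?thesis
    using c not_dvd_geometric_sum[OF pow(1) q(2)] pp unfolding v_def[symmetric]
    by (intro exI[of _ "c * (\<Sum>i<q. (a ^ (p ^ v)) ^ i)"]) (auto simp: prime_dvd_mult_iff)
qed

lemma prime_power_dvd_cancel:
  fixes c b :: int
  assumes "prime p" "\<not> int p dvd c" "int p ^ n dvd b * c"
  shows "int p ^ n dvd b"
proof -
  have "coprime (int p ^ n) c" using assms(1,2)
    by (meson coprime_power_left_iff prime_imp_coprime prime_nat_int_transfer)
  then show ?thesis using assms(3) by (simp add: coprime_dvd_mult_left_iff)
qed

lemma dvd_power_minus_one_iff:
  fixes a :: int and p m :: nat
  assumes "prime p" and "int p dvd a - 1" and "p = 2 \<Longrightarrow> 4 dvd a - 1" and "m > 0"
  shows "int p ^ n dvd a ^ m - 1 \<longleftrightarrow> int p ^ n dvd (a - 1) * int p ^ multiplicity p m"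
  using lifting_the_exponent[OF assms] prime_power_dvd_cancel[OF assms(1)]
  by (metis dvd_mult2)

section \<open>The exponent of the level at one prime\<close>

text \<open>
  For \<open>n\<close> the exponent of \<open>p\<close> in \<open>N\<close>, so that \<open>n div 2\<close> is its exponent in \<open>square_part N\<close>,
  the following two properties say that \<open>p\<^sup>l\<close> is an admissible local factor of the level, and that
  no larger level can occur: for \<open>l < n div 2\<close> an obstruction comes either from a diagonal torsion
  element or from conjugates of unipotent elements.
\<close>

definition level_fits :: "nat \<Rightarrow> nat \<Rightarrow> nat \<Rightarrow> nat \<Rightarrow> bool" where
  "level_fits p m n l \<longleftrightarrow> l \<le> n div 2 \<and>
     (l > 0 \<longrightarrow> (\<forall>e. int p ^ n dvd e ^ m - 1 \<longrightarrow>
        int p ^ l dvd e\<^sup>2 - 1 \<and>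
        (\<forall>i j. int p ^ n dvd (1 + i * (e\<^sup>2 - 1) + int p ^ (n - l) * j) ^ m - 1)))"

definition level_sharp :: "nat \<Rightarrow> nat \<Rightarrow> nat \<Rightarrow> nat \<Rightarrow> bool" where
  "level_sharp p m n l \<longleftrightarrow> n div 2 \<le> l \<or>
     (\<exists>e. int p ^ n dvd e ^ m - 1 \<and> \<not> int p ^ Suc l dvd e\<^sup>2 - 1) \<or>
     (\<forall>X. int p ^ n dvd (1 + int p ^ (n - n div 2) * X) ^ m - 1 \<longrightarrow>
        int p ^ (n div 2) dvd int p ^ l * X)"

text \<open>Serves the last alternative of \<open>level_sharp\<close>. Taking m-th powers multiplies
  the distance to 1 by p to the exponent of p in m, up to a p-unit. If p does not divide m, the
  geometric sum is itself a p-unit; this covers p = 2 with n - k = 1, where lifting the exponent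
  would fail.\<close>

lemma torsion_imp_dvd:
  fixes X :: int
  assumes p: "prime p" and m: "m > 0" and k: "k \<ge> 1" "k \<le> n" and two: "p = 2 \<Longrightarrow> even m \<Longrightarrow> n - k \<ge> 2"
    and tors: "int p ^ n dvd (1 + int p ^ (n - k) * X) ^ m - 1" and nk: "n - k \<ge> 1"
  shows "int p ^ k dvd int p ^ multiplicity p m * X"
proof -
  have "int p ^ n = int p ^ (n - k) * int p ^ k" using k by (simp flip: power_add)
  moreover have "int p ^ n dvd int p ^ (n - k) * X * int p ^ multiplicity p m"
  proof (cases "p dvd m")
    case True
    have "p = 2 \<Longrightarrow> 4 dvd int p ^ (n - k)"
      using le_imp_power_dvd[of 2 "n - k" "2::int"] two True by simp
    then have "p = 2 \<Longrightarrow> 4 dvd (1 + int p ^ (n - k) * X) - 1" by auto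
    moreover have "int p dvd (1 + int p ^ (n - k) * X) - 1"
    proof -
      have "int p dvd int p ^ (n - k)" using nk by (intro dvd_power) auto
      then show ?thesis by simp
    qed
    ultimately show ?thesis
      using dvd_power_minus_one_iff[OF p _ _ m, of "1 + int p ^ (n - k) * X" n] tors by simp
  next
    case False
    have "(1 + int p ^ (n - k) * X) ^ m - 1
        = int p ^ (n - k) * X * (\<Sum>i<m. (1 + int p ^ (n - k) * X) ^ i)"
      by (simp add: power_diff_1_eq)
    moreover have "\<not> int p dvd (\<Sum>i<m. (1 + int p ^ (n - k) * X) ^ i)"
    proof (rule not_dvd_geometric_sum[OF _ False])
      have "int p dvd int p ^ (n - k)" using nk by (intro dvd_power) auto
      then show "int p dvd 1 + int p ^ (n - k) * X - 1" by simp
    qed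
    ultimately have "int p ^ n dvd int p ^ (n - k) * X"
      using tors prime_power_dvd_cancel[OF p] by metis
    then show ?thesis by simp
  qed
  ultimately show ?thesis using p by (simp add: mult.assoc mult.commute[of X])
qed

text \<open>Here m-torsion elements that are 1 modulo p are 1 modulo p^n, so the unipotent
  obstruction already demands the full power p^(n div 2).\<close>

lemma level_not_dvd:
  assumes "prime p" "m > 0" "\<not> p dvd m"
  shows "level_fits p m n 0" "level_sharp p m n 0"
proof -
  have "int p ^ (n div 2) dvd X" if "int p ^ n dvd (1 + int p ^ (n - n div 2) * X) ^ m - 1"
    "n div 2 > 0" for X
  proof -
    have "int p ^ (n div 2) dvd int p ^ multiplicity p m * X"
      using that assms by (intro torsion_imp_dvd) auto
    then show ?thesis using assms by (simp add: not_dvd_imp_multiplicity_0)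
  qed
  then show "level_sharp p m n 0" by (auto simp: level_sharp_def)
qed (auto simp: level_fits_def)

text \<open>There is an m-torsion element whose order modulo p is gcd (p - 1) m > 2, so its square
  is not even 1 modulo p.\<close>

lemma level_large_torsion:
  assumes p: "prime p" and m: "m > 0" and gcd: "gcd (p - 1) m > 2"
  shows "level_fits p m n 0" "level_sharp p m n 0"
proof -
  define d where "d = gcd (p - 1) m"
  have p1: "p > 1" using p prime_gt_1_nat by blast
  have dvd: "d dvd p - 1" "d dvd m" by (auto simp: d_def)
  obtain g where g: "coprime p g" "ord p g = p - 1"
    using prime_primitive_root_exists[OF _ p] p1 p
    unfolding residue_primroot_def by (auto simp: totient_prime)
  \<comment> \<open>The exponent is \<open>totient (p ^ n)\<close> divided by d, so Euler's theorem
    gives e^d = 1 modulo p^n. The factor p^(n - 1) is prime to p - 1 and therefore leaves the order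
    of e modulo p equal to d. For n = 0 the torsion claim is trivial.\<close>
  define e where "e = int (g ^ (p ^ (n - 1) * ((p - 1) div d)))"
  have "int p ^ n dvd e ^ m - 1"
  proof (cases "n = 0")
    case False
    have "[g ^ totient (p ^ n) = 1] (mod p ^ n)" using g False by (intro euler_theorem) (simp add: coprime_commute)
    moreover have "totient (p ^ n) = p ^ (n - 1) * ((p - 1) div d) * d"
      using False p dvd by (simp add: totient_prime_power)
    ultimately have "[(g ^ (p ^ (n - 1) * ((p - 1) div d))) ^ d = 1] (mod p ^ n)"
      by (simp only: power_mult)
    then have "[((g ^ (p ^ (n - 1) * ((p - 1) div d))) ^ d) ^ (m div d) = 1 ^ (m div d)] (mod p ^ n)"
      by (rule cong_pow)
    then have "[(g ^ (p ^ (n - 1) * ((p - 1) div d))) ^ m = 1] (mod p ^ n)"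
      using dvd by (simp add: mult.assoc flip: power_mult)
    then show ?thesis unfolding e_def
      by (metis cong_iff_dvd_diff cong_int_iff of_nat_1 of_nat_power)
  qed simp
  moreover have "\<not> int p ^ Suc 0 dvd e\<^sup>2 - 1"
  proof
    assume "int p ^ Suc 0 dvd e\<^sup>2 - 1"
    then have "[int (g ^ (p ^ (n - 1) * ((p - 1) div d) * 2)) = int 1] (mod int p)"
      unfolding e_def by (simp add: cong_iff_dvd_diff flip: power_mult)
    then have "[g ^ (p ^ (n - 1) * ((p - 1) div d) * 2) = 1] (mod p)"
      by (simp only: cong_int_iff)
    then have "p - 1 dvd p ^ (n - 1) * ((p - 1) div d) * 2"
      using ord_divides[of g _ p] g by (simp add: coprime_commute)
    then have "p - 1 dvd p ^ (n - 1) * (((p - 1) div d) * 2)" by (simp add: mult_ac)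
    moreover have "coprime (p - 1) (p ^ (n - 1))"
      using p1 by (intro coprime_power_right_iff[THEN iffD2] disjI1) (metis coprime_Suc_left_nat coprime_diff_one_left_nat gr_implies_not0 not_gr0)
    ultimately have "p - 1 dvd ((p - 1) div d) * 2" by (simp add: coprime_dvd_mult_right_iff)
    then have "((p - 1) div d) * d dvd ((p - 1) div d) * 2" using dvd by simp
    moreover have "(p - 1) div d > 0" using dvd p1 by (auto simp: div_greater_zero_iff dvd_imp_le d_def)
    ultimately have "d dvd 2" by simp
    then show False using gcd unfolding d_def[symmetric] by (auto dest: dvd_imp_le)
  qed
  ultimately show "level_sharp p m n 0" unfolding level_sharp_def by blast
qed (auto simp: level_fits_def)

text \<open>The order modulo p of a torsion unit divides gcd (p - 1) m, so its square is 1 modulo p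
  and lifting gives 1 modulo p^R. Conversely, everything that is 1 modulo p^R is torsion, and l <= v
  yields R <= n - l. Sharpness has two sources: unipotents if l = v, and the unit 1 + p^R if l = R,
  whose square is no closer to 1 as p is odd.\<close>

lemma level_odd:
  assumes p: "prime p" "p \<noteq> 2" and m: "m > 0" "p dvd m" and gcd: "gcd (p - 1) m \<le> 2"
    and n: "n \<ge> 2"
  defines "l \<equiv> min (multiplicity p m) (max (n - multiplicity p m) 1)"
  shows "level_fits p m n l" "level_sharp p m n l"
proof -
  define v where "v = multiplicity p m"
  define R where "R = max (n - v) 1"
  have l: "l = min v R" by (simp add: l_def v_def R_def)
  have v: "v \<ge> 1" using m p unfolding v_def by (simp add: Suc_leI prime_multiplicity_gt_zero_iff)
  have R: "R \<ge> 1" "R + v \<ge> n" by (auto simp: R_def)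
  have tors: "int p ^ n dvd (1 + int p ^ R * c) ^ m - 1" for c
  proof -
    have "int p ^ (R + v) dvd (1 + int p ^ R * c - 1) * int p ^ v"
      by (simp add: power_add mult_ac)
    then have "int p ^ n dvd (1 + int p ^ R * c - 1) * int p ^ v"
      using R(2) power_le_dvd by blast
    then show ?thesis
      using dvd_power_minus_one_iff[OF p(1) _ _ m(1), of "1 + int p ^ R * c" n] p R
      by (auto simp: v_def dvd_power)
  qed
  have sq: "int p ^ R dvd e\<^sup>2 - 1" if e: "int p ^ n dvd e ^ m - 1" for e
  proof -
    have "int p dvd e ^ m - 1" using e n dvd_trans[OF dvd_power[of n "int p"]] by simp
    then have em: "[e ^ m = 1] (mod int p)" by (simp add: cong_iff_dvd_diff)
    have e1: "[e\<^sup>2 = 1] (mod int p)"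
    proof -
      define f where "f = nat (e mod int p)"
      have ef: "[e = int f] (mod int p)" using p by (simp add: f_def prime_gt_0_nat)
      have fm: "[f ^ m = 1] (mod p)"
        using em cong_pow[OF ef, of m] by (metis cong_int_iff cong_sym cong_trans of_nat_1 of_nat_power)
      then have "coprime f p" using m by (metis cong_imp_coprime cong_sym coprime_1_left coprime_power_left_iff neq0_conv)
      then have "ord p f dvd p - 1" using order_divides_totient[of p f] p by (simp add: totient_prime coprime_commute)
      then have "ord p f dvd gcd (p - 1) m" using fm ord_divides by (metis gcd_greatest)
      then have "ord p f dvd 2" using gcd
        by (metis One_nat_def Suc_1 dvd_refl dvd_trans gcd_eq_0_iff le_Suc_eq le_zero_eq m(1) one_dvd not_gr0)
      then have "[f\<^sup>2 = 1] (mod p)" using ord_divides by blast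
      then have "[int f ^ 2 = 1] (mod int p)" by (metis cong_int_iff of_nat_1 of_nat_power)
      then show ?thesis using cong_pow[OF ef, of 2] cong_trans by blast
    qed
    then have d1: "int p dvd e\<^sup>2 - 1" by (simp add: cong_iff_dvd_diff)
    have "e ^ m - 1 dvd (e\<^sup>2) ^ m - 1"
      by (metis dvd_triv_left power_diff_1_eq power_mult mult.commute)
    then have "int p ^ n dvd (e\<^sup>2 - 1) * int p ^ v"
      using e dvd_power_minus_one_iff[OF p(1) d1 _ m(1), of n] p unfolding v_def by (meson dvd_trans)
    then have "int p ^ (n - v) dvd e\<^sup>2 - 1"
    proof (cases "v \<le> n")
      case True
      then have "int p ^ n = int p ^ (n - v) * int p ^ v" by (simp flip: power_add)
      then show ?thesis using \<open>int p ^ n dvd (e\<^sup>2 - 1) * int p ^ v\<close> p by (simp add: prime_gt_0_nat)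
    qed simp
    then show ?thesis using d1 by (simp add: R_def max_def)
  qed
  have "l \<le> n div 2" using n by (auto simp: l R_def)
  moreover have "int p ^ R dvd int p ^ (n - l)"
  proof (rule le_imp_power_dvd)
    show "R \<le> n - l" using n v by (auto simp: l R_def)
  qed
  moreover have "int p ^ l dvd int p ^ R" by (rule le_imp_power_dvd) (simp add: l)
  ultimately show "level_fits p m n l"
    unfolding level_fits_def
  proof (intro conjI impI allI)
    fix e i j assume e: "int p ^ n dvd e ^ m - 1" and *: "int p ^ R dvd int p ^ (n - l)"
    have "int p ^ R dvd i * (e\<^sup>2 - 1) + int p ^ (n - l) * j" using sq[OF e] * by simp
    then obtain c where "i * (e\<^sup>2 - 1) + int p ^ (n - l) * j = int p ^ R * c" by blast
    then show "int p ^ n dvd (1 + i * (e\<^sup>2 - 1) + int p ^ (n - l) * j) ^ m - 1"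
      using tors[of c] by (simp add: add.assoc)
  qed (use sq dvd_trans in blast)+
  show "level_sharp p m n l"
  proof (cases "l = v")
    case True
    have "int p ^ (n div 2) dvd int p ^ multiplicity p m * X"
      if "int p ^ n dvd (1 + int p ^ (n - n div 2) * X) ^ m - 1" for X
      using that p m n by (intro torsion_imp_dvd) auto
    then show ?thesis unfolding level_sharp_def using True v_def by blast
  next
    case False
    then have lR: "l = R" by (simp add: l)
    have "(1 + int p ^ R)\<^sup>2 - 1 = int p ^ R * (2 + int p ^ R)"
      by (simp add: power2_eq_square algebra_simps)
    moreover have "\<not> int p dvd 2 + int p ^ R"
    proof -
      have "\<not> int p dvd 2" using p by (metis int_dvd_int_iff of_nat_numeral primes_dvd_imp_eq two_is_prime_nat)
      then show ?thesis using R by (simp add: dvd_add_left_iff dvd_power)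
    qed
    ultimately have "\<not> int p ^ Suc l dvd (1 + int p ^ R)\<^sup>2 - 1"
      using p by (simp add: lR prime_gt_0_nat mult.commute)
    then show ?thesis unfolding level_sharp_def using tors[of 1] by auto
  qed
qed

text \<open>Lifting needs a base that is 1 modulo 4, so it is applied to e^2 with exponent m / 2;
  this is why v - 1 appears. If n <= v + 2, all odd numbers are torsion and the constant 3 is the
  exponent of 3^2 - 1 = 8. Otherwise torsion forces 2^(n + 1 - v) to divide e^2 - 1, and 1 + 2^(n -
  v) shows that no more is forced.\<close>

lemma level_two:
  assumes m: "m > 0" "even m" and n: "n \<ge> 2"
  defines "v \<equiv> multiplicity 2 m"
  defines "l \<equiv> min (n div 2) (if n \<le> v + 2 then 3 else min v (n + 1 - v))"
  shows "level_fits 2 m n l" "level_sharp 2 m n l"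
proof -
  have v: "v \<ge> 1" using m unfolding v_def by (simp add: Suc_leI prime_multiplicity_gt_zero_iff)
  obtain m' where m': "m = 2 * m'" using m by blast
  then have m'0: "m' > 0" using m by simp
  have vm': "v = Suc (multiplicity 2 m')" unfolding v_def m' using m'0
    by (simp add: multiplicity_times_same)
  have p2: "prime (2::nat)" by simp
  have sq8: "8 dvd e\<^sup>2 - 1" if "odd e" for e :: int
  proof -
    obtain c where c: "e = 2 * c + 1" using \<open>odd e\<close> oddE by blast
    have "even (c * (c + 1))" by simp
    then obtain d where "c * (c + 1) = 2 * d" by blast
    moreover have "e\<^sup>2 - 1 = 4 * (c * (c + 1))" by (simp add: c power2_eq_square algebra_simps)
    ultimately show ?thesis by simp
  qed
  have sq_tors: "2 ^ n dvd e ^ m - 1 \<longleftrightarrow> 2 ^ n dvd (e\<^sup>2 - 1) * 2 ^ (v - 1)" if "odd e" for e :: int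
  proof -
    have "(4::int) dvd 8" by simp
    then have "4 dvd e\<^sup>2 - 1" using sq8[OF that] dvd_trans by blast
    then show ?thesis using dvd_power_minus_one_iff[OF p2 _ _ m'0, of "e\<^sup>2" n] that
      by (simp add: m' power_mult vm')
  qed
  have tors4: "2 ^ n dvd e ^ m - 1" if "2 ^ (n - v) dvd e - 1" "n > v + 2" for e :: int
  proof -
    have "(2::int) ^ 2 dvd 2 ^ (n - v)" using that by (intro le_imp_power_dvd) auto
    then have "4 dvd e - 1" using that dvd_trans by auto
    moreover have "(2::int) dvd 4" by simp
    ultimately have "2 dvd e - 1" using dvd_trans by blast
    have "(2::int) ^ (n - v) * 2 ^ v dvd (e - 1) * 2 ^ v" using that by simp
    then have "2 ^ n dvd (e - 1) * 2 ^ v" using that by (simp flip: power_add)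
    then show ?thesis
      using dvd_power_minus_one_iff[OF p2 _ _ m(1), of e n] \<open>4 dvd e - 1\<close> \<open>2 dvd e - 1\<close>
      by (simp add: v_def)
  qed
  have tors_odd: "2 ^ n dvd e ^ m - 1" if "odd e" "n \<le> v + 2" for e :: int
  proof -
    have "(8::int) * 2 ^ (v - 1) dvd (e\<^sup>2 - 1) * 2 ^ (v - 1)" using sq8 that by (intro mult_dvd_mono) auto
    moreover have "(8::int) * 2 ^ (v - 1) = 2 ^ (v + 2)" using v by (cases v) (auto simp: power_add)
    ultimately have "2 ^ (v + 2) dvd (e\<^sup>2 - 1) * 2 ^ (v - 1)" by metis
    then show ?thesis using sq_tors that power_le_dvd by blast
  qed
  have odd: "odd e" if "2 ^ n dvd e ^ m - 1" for e :: int
  proof -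
    have "(2::int) dvd 2 ^ n" using n by (simp add: dvd_power)
    then have "2 dvd e ^ m - 1" using that dvd_trans by blast
    then show ?thesis using m by auto
  qed
  have sq: "2 ^ l dvd e\<^sup>2 - 1" if e: "2 ^ n dvd e ^ m - 1" for e :: int
  proof (cases "n \<le> v + 2")
    case True
    then have "l \<le> 3" by (simp add: l_def)
    then have "(2::int) ^ l dvd 2 ^ 3" by (rule le_imp_power_dvd)
    then show ?thesis using sq8[OF odd[OF e]] dvd_trans by auto
  next
    case False
    have "(2::int) ^ n = 2 ^ (n + 1 - v) * 2 ^ (v - 1)" using v False by (simp flip: power_add)
    then have "2 ^ (n + 1 - v) dvd e\<^sup>2 - 1"
      using e sq_tors[OF odd[OF e]] by simp
    moreover have "l \<le> n + 1 - v" using False by (simp add: l_def)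
    ultimately show ?thesis by (meson power_le_dvd)
  qed
  show "level_fits 2 m n l"
    unfolding level_fits_def
  proof (intro conjI impI allI)
    fix e i j :: int assume "int 2 ^ n dvd e ^ m - 1"
    then have e: "2 ^ n dvd e ^ m - 1" by simp
    have "2 ^ n dvd (1 + i * (e\<^sup>2 - 1) + 2 ^ (n - l) * j) ^ m - 1"
    proof (cases "n \<le> v + 2")
      case True
      \<comment> \<open>Only parity matters here: n - l > 0 keeps the perturbed number odd, and
        every odd number is torsion in this range.\<close>
      have "l \<le> n div 2" by (simp add: l_def)
      then have "n - l > 0" using n by linarith
      then show ?thesis using tors_odd True odd[OF e] by simp
    next
      case False
      have "2 ^ (n + 1 - v) dvd e\<^sup>2 - 1"
      proof -
        have "(2::int) ^ n = 2 ^ (n + 1 - v) * 2 ^ (v - 1)" using v False by (simp flip: power_add)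
        then show ?thesis using e sq_tors[OF odd[OF e]] by simp
      qed
      then have "2 ^ (n - v) dvd e\<^sup>2 - 1" by (rule power_le_dvd) simp
      moreover have "(2::int) ^ (n - v) dvd 2 ^ (n - l)"
        by (rule le_imp_power_dvd) (use False in \<open>simp add: l_def\<close>)
      ultimately show ?thesis using False by (intro tors4) (auto simp: add.assoc)
    qed
    then show "int 2 ^ n dvd (1 + i * (e\<^sup>2 - 1) + int 2 ^ (n - l) * j) ^ m - 1" by simp
  qed (use sq in \<open>auto simp: l_def\<close>)
  show "level_sharp 2 m n l"
  proof (cases "n \<le> v + 2")
    case True
    show ?thesis
    proof (cases "n div 2 \<le> 3")
      case False
      then have "l = 3" using True by (simp add: l_def)
      then have "int 2 ^ n dvd 3 ^ m - 1 \<and> \<not> int 2 ^ Suc l dvd 3\<^sup>2 - 1"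
        using tors_odd[OF _ True, of 3] by simp
      then show ?thesis unfolding level_sharp_def by blast
    qed (use True in \<open>simp add: level_sharp_def l_def\<close>)
  next
    case False
    then have "n div 2 \<le> l \<or> l = v \<or> l = n + 1 - v" by (simp add: l_def min_def)
    then consider "n div 2 \<le> l" | "l = v" | "l = n + 1 - v" by blast
    then show ?thesis
    proof cases
      case 2
      have "int 2 ^ (n div 2) dvd int 2 ^ multiplicity 2 m * X"
        if "int 2 ^ n dvd (1 + int 2 ^ (n - n div 2) * X) ^ m - 1" for X
        using that m n False v by (intro torsion_imp_dvd) auto
      then show ?thesis unfolding level_sharp_def using 2 v_def by blast
    next
      case 3
      have "(1 + 2 ^ (n - v))\<^sup>2 - 1 = (2::int) ^ (n - v) * 2 * (1 + 2 ^ (n - v - 1))"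
      proof -
        have "(2::int) ^ (n - v) = 2 * 2 ^ (n - v - 1)" using False by (simp flip: power_Suc)
        then show ?thesis by (simp add: power2_eq_square algebra_simps)
      qed
      also have "(2::int) ^ (n - v) * 2 = 2 ^ l" using 3 False by (simp add: Suc_diff_le)
      finally have "\<not> int 2 ^ Suc l dvd (1 + 2 ^ (n - v))\<^sup>2 - 1" using False by (simp add: mult.commute)
      moreover have "int 2 ^ n dvd (1 + 2 ^ (n - v)) ^ m - 1" using tors4[of "1 + 2 ^ (n - v)"] False by simp
      ultimately show ?thesis unfolding level_sharp_def by blast
    qed (simp add: level_sharp_def)
  qed
qed

section \<open>Gluing the local conditions\<close>

lemma unit_torsion_iff:
  assumes "m > 0"
  shows "x \<in> unit_torsion m N \<longleftrightarrow> int N dvd x ^ m - 1"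
proof -
  have "coprime x (int N)" if "[x ^ m = 1] (mod int N)"
  proof -
    have "coprime (x ^ m) (int N)" by (rule cong_imp_coprime[OF cong_sym[OF that]]) simp
    then show ?thesis using assms by simp
  qed
  then show ?thesis by (auto simp: unit_torsion_def cong_iff_dvd_diff)
qed

lemma power_multiplicity_dvd: "int p ^ multiplicity p n dvd int n"
  unfolding of_nat_power[symmetric] int_dvd_int_iff by (rule multiplicity_dvd)

lemma int_dvd_by_primes:
  fixes a :: int
  assumes n: "n > 0" and *: "\<And>p. prime p \<Longrightarrow> int p ^ multiplicity p n dvd a"
  shows "int n dvd a"
proof (cases "a = 0")
  case False
  have "n dvd nat \<bar>a\<bar>"
  proof (rule multiplicity_le_imp_dvd)
    fix p :: nat assume p: "prime p"
    have "p ^ multiplicity p n dvd nat \<bar>a\<bar>"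
      using *[OF p] unfolding of_nat_power[symmetric] dvd_nat_abs_iff .
    then show "multiplicity p n \<le> multiplicity p (nat \<bar>a\<bar>)"
      using False p by (intro multiplicity_geI) auto
  qed (use n False in auto)
  then show ?thesis unfolding dvd_nat_abs_iff .
qed simp

lemma multiplicity_decompose_prime:
  fixes n p :: nat
  assumes "prime p" "n > 0"
  obtains q where "n = p ^ multiplicity p n * q" "\<not> p dvd q"
proof (rule multiplicity_decompose'[of n p])
  show "\<not> is_unit p" using assms not_prime_unit by blast
qed (use assms in auto)

lemma prime_power_dvd_cancel_left:
  fixes c b :: int
  assumes "prime p" "\<not> int p dvd c" "int p ^ n dvd c * b"
  shows "int p ^ n dvd b"
  using prime_power_dvd_cancel[OF assms(1,2)] assms(3) by (simp only: mult.commute)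

text \<open>At most l of the k factors p can come from b. With b = e^2 - 1 this turns a unit
  violating the congruence into a divisibility of xy and zw.\<close>

lemma prime_power_dvd_mult_cases:
  fixes a b :: int
  assumes p: "prime p" and "int p ^ k dvd a * b" "\<not> int p ^ Suc l dvd b"
  shows "int p ^ k dvd int p ^ l * a"
proof -
  have "b \<noteq> 0" using assms(3) by auto
  moreover have "\<not> is_unit (int p)" using prime_gt_1_nat[OF p] by simp
  ultimately obtain c where c: "b = int p ^ multiplicity (int p) b * c" "\<not> int p dvd c"
    by (rule multiplicity_decompose')
  define i where "i = multiplicity (int p) b"
  have b: "b = int p ^ i * c" using c(1) by (simp only: i_def)
  have "i \<le> l"
    using assms(3) multiplicity_dvd'[of "Suc l" "int p" b] unfolding i_def by linarith
  then have "int p ^ i * a dvd int p ^ l * a" by (intro mult_dvd_mono le_imp_power_dvd) auto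
  moreover have "int p ^ k dvd (int p ^ i * a) * c"
    using assms(2) unfolding b by (simp only: mult_ac)
  then have "int p ^ k dvd int p ^ i * a" by (rule prime_power_dvd_cancel[OF p c(2)])
  ultimately show ?thesis using dvd_trans by blast
qed

text \<open>All that the matrix argument needs to know about sigma is its behaviour at each prime.
  The explicit formula of the theorem stays outside and is matched in
  \<open>torsion_level_prod\<close> and \<open>sigma_level_eq\<close>.\<close>

locale torsion_level =
  fixes N m \<sigma> :: nat
  assumes N: "N > 0" and m: "m > 0" and \<sigma>: "\<sigma> > 0"
    and fits: "prime p \<Longrightarrow> level_fits p m (multiplicity p N) (multiplicity p \<sigma>)"
    and sharp: "prime p \<Longrightarrow> level_sharp p m (multiplicity p N) (multiplicity p \<sigma>)"
begin

abbreviation "s \<equiv> square_part N"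

lemma s_pos: "s > 0" by (rule gr0I) (use N in simp)

lemma multiplicity_s: "prime p \<Longrightarrow> multiplicity p s = multiplicity p N div 2"
  by (rule prime_multiplicity_square_part)

lemma fits_le: "prime p \<Longrightarrow> multiplicity p \<sigma> \<le> multiplicity p N div 2"
  by (rule fits[unfolded level_fits_def, THEN conjunct1])

lemmas fits_torsion = fits[unfolded level_fits_def, THEN conjunct2, rule_format]

lemma level_dvd: "\<sigma> dvd s"
  by (rule multiplicity_le_imp_dvd) (use \<sigma> s_pos N fits_le in \<open>auto simp: multiplicity_s\<close>)

lemma s_dvd: "s dvd N"
  by (rule dvd_trans[OF dvd_power[of 2] square_part_square_dvd]) simp

lemma multiplicity_level_le: "prime p \<Longrightarrow> multiplicity p \<sigma> \<le> multiplicity p N"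
  using fits_le[of p] div_le_dividend[of "multiplicity p N" 2] by linarith

lemma torsion_at:
  assumes "int N dvd e ^ m - 1" shows "int p ^ multiplicity p N dvd e ^ m - 1"
  by (rule dvd_trans[OF power_multiplicity_dvd assms])

lemma level_dvd_square:
  assumes "int N dvd e ^ m - 1"
  shows "int \<sigma> dvd e\<^sup>2 - 1"
proof (rule int_dvd_by_primes[OF \<sigma>])
  fix p :: nat assume p: "prime p"
  show "int p ^ multiplicity p \<sigma> dvd e\<^sup>2 - 1"
  proof (cases "multiplicity p \<sigma> = 0")
    case False
    then show ?thesis using fits_torsion[OF p _ torsion_at[OF assms]] by simp
  qed simp
qed

lemma torsion_inverse:
  assumes "int N dvd e ^ m - 1" "int N dvd e * h - 1"
  shows "int N dvd h ^ m - 1"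
proof -
  have "e * h - 1 dvd (e * h) ^ m - 1" by (subst power_diff_1_eq) simp
  then have "int N dvd (e * h) ^ m - 1" by (rule dvd_trans[OF assms(2)])
  then have "int N dvd ((e * h) ^ m - 1) - (e ^ m - 1) * h ^ m" using assms by simp
  also have "((e * h) ^ m - 1) - (e ^ m - 1) * h ^ m = h ^ m - 1"
    by (simp add: algebra_simps power_mult_distrib)
  finally show ?thesis .
qed

lemma level_dvd_diff:
  assumes "int N dvd e ^ m - 1" "int N dvd e * h - 1"
  shows "int \<sigma> dvd h - e"
proof -
  have "\<sigma> dvd N" by (rule dvd_trans[OF level_dvd s_dvd])
  then have *: "int \<sigma> dvd e * h - 1" using dvd_trans[OF _ assms(2)] by simp
  have "int \<sigma> dvd (h\<^sup>2 - 1) * e" using level_dvd_square[OF torsion_inverse[OF assms]] by simp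
  moreover have "h - e = (h\<^sup>2 - 1) * e - (e * h - 1) * h" by (simp add: algebra_simps power2_eq_square)
  ultimately show ?thesis using dvd_diff[OF _ dvd_mult2[OF *, of h]] by simp
qed

text \<open>The expression is the upper left entry computed in \<open>conj_scaled_mat\<close>. Via
  the determinant it becomes e or h plus a multiple of e - h plus a term Y, of which a priori only
  sigma * Y is divisible by N.\<close>

lemma conj_torsion:
  fixes x y z w e f g h :: int and t t' :: nat
  assumes det: "x * w * t - y * z * t' = 1" and Nt: "N = s\<^sup>2 * (t * t')"
    and xz: "int s dvd \<sigma> * (x * z)" and yw: "int s dvd \<sigma> * (y * w)"
    and xy: "int s dvd \<sigma> * (x * y)" and zw: "int s dvd \<sigma> * (z * w)"
    and B: "e * h - N * f * g = 1" and e: "int N dvd e ^ m - 1"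
  shows "int N dvd (x * w * t * e - y * z * t' * h + int (s * t * t') * (y * w * g - x * z * f)) ^ m - 1"
    (is "_ dvd ?E ^ m - 1")
proof (rule int_dvd_by_primes[OF N])
  fix p :: nat assume p: "prime p"
  then have pp: "prime (int p)" by simp
  define n where "n = multiplicity p N"
  define l where "l = multiplicity p \<sigma>"
  define k where "k = multiplicity p s"
  define Y where "Y = int (s * t * t') * (y * w * g - x * z * f)"
  have nz: "s > 0" "t > 0" "t' > 0" using N Nt by (auto intro: Nat.gr0I)
  have n: "n = 2 * k + multiplicity p t + multiplicity p t'"
    unfolding n_def k_def using nz p N
    by (subst Nt) (simp add: prime_elem_multiplicity_mult_distrib prime_elem_multiplicity_power_distrib
        prime_imp_prime_elem)
  have "e * h - 1 = int N * (f * g)" using B by (simp add: algebra_simps)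
  then have eh: "int N dvd e * h - 1" by simp
  have h: "int N dvd h ^ m - 1" by (rule torsion_inverse[OF e eh])
  have pn: "int p ^ n dvd int N" unfolding n_def by (rule power_multiplicity_dvd)
  have "int N = int s * int (s * t * t')" by (subst Nt) (simp add: power2_eq_square)
  then have "int N dvd \<sigma> * (x * z) * int (s * t * t')" "int N dvd \<sigma> * (y * w) * int (s * t * t')"
    using mult_dvd_mono[OF xz, of "int (s * t * t')" "int (s * t * t')"]
      mult_dvd_mono[OF yw, of "int (s * t * t')" "int (s * t * t')"] by simp_all
  then have "int N dvd (\<sigma> * (y * w) * int (s * t * t')) * g - (\<sigma> * (x * z) * int (s * t * t')) * f"
    by simp
  also have "\<dots> = \<sigma> * Y" by (simp add: Y_def algebra_simps)
  finally have Y: "int p ^ n dvd \<sigma> * Y" using pn dvd_trans by blast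
  have xw: "x * w * t = 1 + y * z * t'" using det by simp
  have E: "?E = e + y * z * t' * (e - h) + Y" "?E = h + x * w * t * (e - h) + Y"
    unfolding Y_def xw by (simp_all add: algebra_simps)
  have cong: "int p ^ n dvd ?E ^ m - 1" if "int p ^ n dvd ?E - E'" "int p ^ n dvd E' ^ m - 1" for E'
  proof -
    have "[?E ^ m = E' ^ m] (mod int p ^ n)" using that by (intro cong_pow) (simp add: cong_iff_dvd_diff)
    also have "[E' ^ m = 1] (mod int p ^ n)" using that by (simp add: cong_iff_dvd_diff)
    finally show ?thesis by (simp add: cong_iff_dvd_diff)
  qed
  have "int p ^ n dvd ?E ^ m - 1"
  proof (cases "l = 0")
    \<comment> \<open>\<open>level_fits\<close> promises nothing for l = 0. In exchange sigma is
      prime to p, so p^k divides all four products and N contains no more factors p than Y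
      does.\<close>
    case True
    then have p\<sigma>: "\<not> int p dvd int \<sigma>" using p \<sigma> multiplicity_eq_zero_iff[of \<sigma> p] prime_gt_1_nat[OF p] by (auto simp: l_def)
    have Y': "int p ^ n dvd Y" using Y by (rule prime_power_dvd_cancel_left[OF p p\<sigma>])
    have ks: "int p ^ k dvd int s" unfolding k_def by (rule power_multiplicity_dvd)
    have pk: "int p ^ k dvd x * z" "int p ^ k dvd y * w" "int p ^ k dvd x * y" "int p ^ k dvd z * w"
      by (rule prime_power_dvd_cancel_left[OF p p\<sigma> dvd_trans[OF ks]], fact)+
    \<comment> \<open>Modulo \<open>p\<^sup>n\<close> one of the two terms of the determinant vanishes, so the conjugation by \<open>A\<close>
      acts on the diagonal either trivially or by inversion.\<close>
    show ?thesis
    proof (cases "int p dvd y * z * t'")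
      case True
      then have "\<not> int p dvd x * w * t" using det pp
        by (metis dvd_diff not_prime_unit)
      then have nd: "\<not> int p dvd x" "\<not> int p dvd w" "\<not> p dvd t" by auto
      then have "multiplicity p t = 0" using not_dvd_imp_multiplicity_0 by blast
      then have n': "n = k + k + multiplicity p t'" using n by simp
      have "int p ^ k dvd y" "int p ^ k dvd z"
        using pk prime_power_dvd_cancel_left[OF p nd(1)] prime_power_dvd_cancel[OF p nd(2)] by blast+
      then have "int p ^ n dvd y * z * t'" unfolding n' power_add
        by (intro mult_dvd_mono power_multiplicity_dvd)
      then show ?thesis using E(1) Y' torsion_at[OF e, of p] by (intro cong[of e]) (auto simp: n_def)
    next
      case False
      then have nd: "\<not> int p dvd y" "\<not> int p dvd z" "\<not> p dvd t'" by auto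
      then have "multiplicity p t' = 0" using not_dvd_imp_multiplicity_0 by blast
      then have n': "n = k + k + multiplicity p t" using n by simp
      have "int p ^ k dvd x" "int p ^ k dvd w"
        using pk prime_power_dvd_cancel_left[OF p nd(1)] prime_power_dvd_cancel[OF p nd(2)]
          prime_power_dvd_cancel[OF p nd(1)] prime_power_dvd_cancel_left[OF p nd(2)] by blast+
      then have "int p ^ n dvd x * w * t" unfolding n' power_add
        by (intro mult_dvd_mono power_multiplicity_dvd)
      then show ?thesis using E(2) Y' torsion_at[OF h, of p] by (intro cong[of h]) (auto simp: n_def)
    qed
  next
    case False
    obtain q where q: "\<sigma> = p ^ l * q" "\<not> p dvd q"
      using multiplicity_decompose_prime[OF p \<sigma>] unfolding l_def .
    have "int \<sigma> = int p ^ l * int q" by (subst q(1)) simp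
    then have "int p ^ n dvd (int p ^ l * Y) * int q" using Y by (simp only: mult_ac)
    moreover have "\<not> int p dvd int q" using q(2) by simp
    ultimately have "int p ^ n dvd int p ^ l * Y" using prime_power_dvd_cancel[OF p] by blast
    moreover have "int p ^ n = int p ^ l * int p ^ (n - l)"
      using multiplicity_level_le[OF p] by (simp add: n_def l_def flip: power_add)
    ultimately have "int p ^ (n - l) dvd Y" using p by (simp add: prime_gt_0_nat)
    then obtain j where j: "Y = int p ^ (n - l) * j" by blast
    \<comment> \<open>Because eh = 1 modulo p^n, the difference e - h is -e(h^2 - 1) and Y is eYh.
      So the entry is e * Q, where Q has the form that \<open>level_fits\<close> controls for the
      torsion unit h.\<close>
    define Q where "Q = 1 + (- (y * z * t')) * (h\<^sup>2 - 1) + int p ^ (n - l) * (j * h)"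
    have "int p ^ n dvd Q ^ m - 1"
      unfolding Q_def n_def l_def
      by (rule fits_torsion[OF p _ torsion_at[OF h], THEN conjunct2, rule_format])
        (use False in \<open>simp add: l_def\<close>)
    then have "int p ^ n dvd (Q ^ m - 1) * e ^ m + (e ^ m - 1)"
      using torsion_at[OF e, of p] by (simp add: n_def)
    also have "(Q ^ m - 1) * e ^ m + (e ^ m - 1) = (e * Q) ^ m - 1"
      by (simp add: algebra_simps power_mult_distrib)
    finally have "int p ^ n dvd (e * Q) ^ m - 1" .
    moreover have "?E - e * Q = (e * h - 1) * (y * z * t' * h - Y)"
      unfolding E(1) Q_def j by (simp add: algebra_simps power2_eq_square)
    then have "int p ^ n dvd ?E - e * Q" by (simp only: dvd_mult2[OF dvd_trans[OF pn eh]])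
    ultimately show ?thesis by (intro cong[of "e * Q"])
  qed
  then show "int p ^ multiplicity p N dvd ?E ^ m - 1" by (simp add: n_def)
qed

text \<open>
  It is enough to test the diagonal elements \<open>e\<close> lifted from one prime by the Chinese remainder theorem
  (second case) and the two elementary unipotent matrices (third case).
\<close>

lemma level_necessary:
  fixes x y z w :: int and t t' :: nat
  assumes det: "x * w * t - y * z * t' = 1" and Nt: "N = s\<^sup>2 * (t * t')"
    and conj: "\<And>(e :: int) (f :: int) (g :: int) (h :: int). e * h - N * f * g = 1 \<Longrightarrow> int N dvd e ^ m - 1 \<Longrightarrow>
      int s dvd x * y * (h - e) \<and> int s dvd z * w * (h - e) \<and>
      int N dvd (x * w * t * e - y * z * t' * h + int (s * t * t') * (y * w * g - x * z * f)) ^ m - 1"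
  shows "int s dvd \<sigma> * (x * y) \<and> int s dvd \<sigma> * (z * w)"
proof -
  have local: "int p ^ multiplicity p s dvd \<sigma> * (x * y) \<and> int p ^ multiplicity p s dvd \<sigma> * (z * w)"
    if p: "prime p" for p
  proof -
    define n where "n = multiplicity p N"
    define l where "l = multiplicity p \<sigma>"
    define k where "k = n div 2"
    have k: "k = multiplicity p s" using p by (simp add: k_def n_def multiplicity_s)
    have ks: "int p ^ k dvd int s" unfolding k by (rule power_multiplicity_dvd)
    have pn: "int p ^ n dvd int N" unfolding n_def by (rule power_multiplicity_dvd)
    have nz: "s > 0" "t > 0" "t' > 0" using N Nt by (auto intro: Nat.gr0I)
    have "int p ^ k dvd int p ^ l * (x * y) \<and> int p ^ k dvd int p ^ l * (z * w)"
    proof -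
      consider "k \<le> l" | e where "\<not> k \<le> l" "int p ^ n dvd e ^ m - 1" "\<not> int p ^ Suc l dvd e\<^sup>2 - 1"
        | "\<And>X. int p ^ n dvd (1 + int p ^ (n - k) * X) ^ m - 1 \<Longrightarrow> int p ^ k dvd int p ^ l * X"
        using sharp[OF p] unfolding level_sharp_def n_def l_def k_def by blast
      then show ?thesis
      proof cases
        case 1
        then show ?thesis by (simp add: le_imp_power_dvd dvd_mult2)
      next
        case (2 e0)
        obtain M where M: "N = p ^ n * M" "\<not> p dvd M"
          using multiplicity_decompose_prime[OF p N] unfolding n_def .
        have "coprime (int p ^ n) (int M)"
          using M p by (metis coprime_int_iff coprime_power_left_iff of_nat_power prime_imp_coprime)
        then obtain e where e: "[e = e0] (mod int p ^ n)" "[e = 1] (mod int M)"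
          using binary_chinese_remainder_int by blast
        have "[e ^ m = e0 ^ m] (mod int p ^ n)" "[e ^ m = 1 ^ m] (mod int M)"
          using e by (auto intro: cong_pow simp del: power_one)
        moreover have "[e0 ^ m = 1] (mod int p ^ n)" using 2 by (simp add: cong_iff_dvd_diff)
        ultimately have "int p ^ n dvd e ^ m - 1" "int M dvd e ^ m - 1"
          by (metis cong_trans cong_iff_dvd_diff, metis cong_iff_dvd_diff power_one)
        then have tors: "int N dvd e ^ m - 1"
          using \<open>coprime (int p ^ n) (int M)\<close> M by (simp add: divides_mult)
        then have "e \<in> unit_torsion m N" using m by (simp add: unit_torsion_iff)
        then have "coprime e (int N)" by (simp add: unit_torsion_def)
        then obtain h where "[e * h = 1] (mod int N)" using cong_solve_coprime_int by blast
        then obtain g where g: "e * h - 1 = int N * g" by (auto simp: cong_iff_dvd_diff)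
        then have "e * h - int N * 1 * g = 1" by simp
        from conj[OF this tors] have sd: "int s dvd x * y * (h - e)" "int s dvd z * w * (h - e)" by auto
        \<comment> \<open>Modulo N, multiplication by e turns h - e into -(e^2 - 1), the quantity
          that \<open>level_sharp\<close> speaks about.\<close>
        have id: "(h - e) * e = int N * g - (e\<^sup>2 - 1)" using g by (simp add: algebra_simps power2_eq_square)
        have "int s dvd int N" using s_dvd by simp
        then have "int p ^ k dvd int N" using ks dvd_trans by blast
        then have red: "int p ^ k dvd a * (e\<^sup>2 - 1)" if "int s dvd a * (h - e)" for a
        proof -
          have "int p ^ k dvd a * (h - e) * e" by (rule dvd_mult2[OF dvd_trans[OF ks that]])
          also have "a * (h - e) * e = int N * (a * g) - a * (e\<^sup>2 - 1)"
            unfolding mult.assoc id by (simp add: algebra_simps)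
          finally have "int p ^ k dvd int N * (a * g) - (int N * (a * g) - a * (e\<^sup>2 - 1))"
            by (rule dvd_diff[OF dvd_mult2[OF \<open>int p ^ k dvd int N\<close>]])
          then show ?thesis by simp
        qed
        \<comment> \<open>As l < n div 2, the modulus p^(l + 1) is still seen by the congruence with
          e0 modulo p^n.\<close>
        have "Suc l \<le> n" using 2 by (simp add: k_def)
        then have "[e = e0] (mod int p ^ Suc l)" using e(1) by (meson cong_dvd_modulus le_imp_power_dvd)
        then have "[e\<^sup>2 - 1 = e0\<^sup>2 - 1] (mod int p ^ Suc l)" by (intro cong_diff cong_pow) auto
        then have "\<not> int p ^ Suc l dvd e\<^sup>2 - 1" using 2 cong_dvd_iff by blast
        then show ?thesis using red sd prime_power_dvd_mult_cases[OF p] by blast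
      next
        case 3
        \<comment> \<open>Since N = s * (s t t'), the exponent of p in s t t' is n - k. Diagonal
          entries of conjugated unipotents thus have the form 1 + p^(n - k) X of the last
          alternative.\<close>
        have "s * t * t' > 0" using nz by simp
        then obtain c where c: "s * t * t' = p ^ multiplicity p (s * t * t') * c" "\<not> p dvd c"
          using multiplicity_decompose_prime[OF p] by blast
        have "n = multiplicity p (s * (s * t * t'))" unfolding n_def by (subst Nt) (simp add: power2_eq_square mult_ac)
        also have "\<dots> = k + multiplicity p (s * t * t')"
          unfolding k using nz p N by (subst prime_elem_multiplicity_mult_distrib) auto
        finally have "multiplicity p (s * t * t') = n - k" by simp
        with c have c': "int (s * t * t') = int p ^ (n - k) * int c" by (metis of_nat_mult of_nat_power)
        have pc: "\<not> int p dvd int c" using c(2) by simp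
        \<comment> \<open>The upper unipotent (f = 1, g = 0) controls xz; the lower one (f = 0, g =
          1) will control yw.\<close>
        have "int N dvd (1 + int (s * t * t') * (- (x * z))) ^ m - 1"
          using conj[of 1 1 1 0] det by simp
        then have "int p ^ k dvd int p ^ l * (int c * (- (x * z)))"
          using 3[of "int c * (- (x * z))"] dvd_trans[OF pn] unfolding c' by (simp only: mult.assoc)
        then have "int p ^ k dvd int p ^ l * (x * z) * int c" by (simp add: mult_ac)
        then have xz: "int p ^ k dvd int p ^ l * (x * z)" by (rule prime_power_dvd_cancel[OF p pc])
        have "int N dvd (1 + int (s * t * t') * (y * w)) ^ m - 1"
          using conj[of 1 1 0 1] det by simp
        then have "int p ^ k dvd int p ^ l * (int c * (y * w))"
          using 3[of "int c * (y * w)"] dvd_trans[OF pn] unfolding c' by (simp only: mult.assoc)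
        then have "int p ^ k dvd int p ^ l * (y * w) * int c" by (simp add: mult_ac)
        then have yw: "int p ^ k dvd int p ^ l * (y * w)" by (rule prime_power_dvd_cancel[OF p pc])
        \<comment> \<open>The determinant prevents p from dividing both xw and yz. Cancelling
          whichever pair consists of p-units transfers the bounds on xz and yw to xy and zw.\<close>
        show ?thesis
        proof (cases "int p dvd y * z")
          case True
          then have "\<not> int p dvd x * w"
            using det p by (metis dvd_diff dvd_mult2 not_prime_unit prime_nat_int_transfer)
          then have "\<not> int p dvd x" "\<not> int p dvd w" by auto
          then have "int p ^ k dvd int p ^ l * y" "int p ^ k dvd int p ^ l * z"
            using yw xz prime_power_dvd_cancel[OF p, of w k "int p ^ l * y"]
              prime_power_dvd_cancel_left[OF p, of x k "int p ^ l * z"] by (simp_all add: mult_ac)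
          then show ?thesis
            using dvd_mult2[of "int p ^ k" "int p ^ l * y" x] dvd_mult2[of "int p ^ k" "int p ^ l * z" w]
            by (simp add: mult_ac)
        next
          case False
          then have "\<not> int p dvd y" "\<not> int p dvd z" by auto
          then have "int p ^ k dvd int p ^ l * x" "int p ^ k dvd int p ^ l * w"
            using yw xz prime_power_dvd_cancel[OF p, of z k "int p ^ l * x"]
              prime_power_dvd_cancel_left[OF p, of y k "int p ^ l * w"] by (simp_all add: mult_ac)
          then show ?thesis
            using dvd_mult2[of "int p ^ k" "int p ^ l * x" y] dvd_mult2[of "int p ^ k" "int p ^ l * w" z]
            by (simp add: mult_ac)
        qed
      qed
    qed
    moreover have "int p ^ l * a dvd int \<sigma> * a" for a
      unfolding l_def by (intro mult_dvd_mono power_multiplicity_dvd dvd_refl)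
    ultimately show ?thesis unfolding k[symmetric] using dvd_trans by blast
  qed
  have "int s dvd \<sigma> * (x * y)" by (rule int_dvd_by_primes[OF s_pos]) (rule local[THEN conjunct1])
  moreover have "int s dvd \<sigma> * (z * w)" by (rule int_dvd_by_primes[OF s_pos]) (rule local[THEN conjunct2])
  ultimately show ?thesis ..
qed

end

section \<open>The level of the theorem\<close>

text \<open>The exponent as it comes out of \<open>level_odd\<close> and \<open>level_two\<close>,
  with truncated subtraction in place of the signed exponents of \<open>sigma_level\<close>.\<close>

definition local_level :: "nat \<Rightarrow> nat \<Rightarrow> nat \<Rightarrow> nat" where
  "local_level N m p =
     (let v = multiplicity p m; n = multiplicity p N in
      if p = 2 then min (n div 2) (if n \<le> v + 2 then 3 else min v (n + 1 - v))
      else min v (max (n - v) 1))"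

definition level_primes :: "nat \<Rightarrow> nat \<Rightarrow> nat set" where
  "level_primes N m = {p. prime p \<and> p dvd gcd m (square_part N) \<and> gcd (p - 1) m \<le> 2}"

lemma finite_level_primes: "m > 0 \<Longrightarrow> finite (level_primes N m)"
  by (rule finite_subset[of _ "{p. p dvd m}"]) (auto simp: level_primes_def)

lemma prime_dvd_square_part_iff:
  fixes p N :: nat
  assumes "prime p" "N > 0"
  shows "p dvd square_part N \<longleftrightarrow> multiplicity p N \<ge> 2"
proof -
  have "p dvd square_part N \<longleftrightarrow> multiplicity p (square_part N) > 0"
    using assms by (subst prime_multiplicity_gt_zero_iff) (auto intro: Nat.gr0I)
  then show ?thesis using assms by (auto simp: prime_multiplicity_square_part)
qed

lemma level_primesD:
  assumes "p \<in> level_primes N m" "N > 0" "m > 0"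
  shows "prime p" "p dvd m" "gcd (p - 1) m \<le> 2" "multiplicity p N \<ge> 2" "multiplicity p m \<ge> 1"
  using assms prime_dvd_square_part_iff[of p N] prime_multiplicity_gt_zero_iff[of p m]
  by (auto simp: level_primes_def Suc_le_eq)

lemma torsion_level_prod:
  assumes N: "N > 0" and m: "m > 0"
  shows "torsion_level N m (\<Prod>p\<in>level_primes N m. p ^ local_level N m p)"
proof
  let ?\<sigma> = "\<Prod>p\<in>level_primes N m. p ^ local_level N m p"
  show "?\<sigma> > 0"
    by (rule prod_pos) (auto simp: level_primes_def prime_gt_0_nat)
  have "level_fits p m (multiplicity p N) (multiplicity p ?\<sigma>) \<and>
        level_sharp p m (multiplicity p N) (multiplicity p ?\<sigma>)" if p: "prime p" for p
  proof -
    have mult: "multiplicity p ?\<sigma> = (if p \<in> level_primes N m then local_level N m p else 0)"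
      using finite_level_primes[OF m] p
      by (intro multiplicity_prod_prime_powers) (auto simp: level_primes_def)
    show ?thesis
    proof (cases "p \<in> level_primes N m")
      case True
      note D = level_primesD[OF True N m]
      show ?thesis
      proof (cases "p = 2")
        case False
        then show ?thesis unfolding mult using level_odd[OF p False m D(2-4)] True
          by (simp add: local_level_def Let_def)
      next
        case two: True
        then show ?thesis unfolding mult using level_two[OF m _ D(4)[unfolded two]] True D(2)
          by (simp add: local_level_def Let_def)
      qed
    next
      case False
      \<comment> \<open>The first two reasons give level 0 by the lemmas for those cases; in the
        third s has no factor p, so no larger exponent is available.\<close>
      then consider "\<not> p dvd m" | "gcd (p - 1) m > 2" | "multiplicity p N div 2 = 0"
        using p prime_dvd_square_part_iff[OF p N] by (force simp: level_primes_def)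
      then show ?thesis
      proof cases
        case 3
        then show ?thesis unfolding mult using False by (simp add: level_fits_def level_sharp_def)
      qed (unfold mult, use False level_not_dvd[OF p m] level_large_torsion[OF p m] in simp_all)
    qed
  qed
  then show "prime p \<Longrightarrow> level_fits p m (multiplicity p N) (multiplicity p ?\<sigma>)"
    "prime p \<Longrightarrow> level_sharp p m (multiplicity p N) (multiplicity p ?\<sigma>)" for p by blast+
qed (use assms in auto)

text \<open>For n >= v + 3 the only discrepancy is the cap n div 2: it lies below min v (n + 1 - v)
  exactly when 2v = n + 1, which is theta. For n <= v + 2 the left side is min (n div 2) 3, and
  separating n = 2, 3, 4, 5 from n >= 6 verifies the corrections.\<close>

lemma local_level_two:
  assumes "multiplicity 2 N \<ge> 2" "multiplicity 2 m \<ge> 1" "N > 0"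
  shows "int (local_level N m 2) = max 1 (min (int (multiplicity 2 m))
            (int (multiplicity 2 (2 * N)) - int (multiplicity 2 m)))
          + (int (epsilon N m) - int (min (theta N m) (multiplicity 2 (square_part N))))"
proof -
  define n where "n = multiplicity 2 N"
  define v where "v = multiplicity 2 m"
  have n: "n \<ge> 2" and v: "v \<ge> 1" using assms by (auto simp: n_def v_def)
  have n1: "multiplicity 2 (2 * N) = n + 1"
    using assms by (simp add: multiplicity_times_same n_def)
  have th: "min (theta N m) (multiplicity 2 (square_part N)) = (if 2 * v = n + 1 then 1 else 0)"
    using n by (auto simp: theta_def n_def v_def prime_multiplicity_square_part)
  have eps: "epsilon N m = (if v \<ge> n \<and> n \<ge> 6 then 2
      else if (v + 1 = n \<and> v \<ge> 5) \<or> (v \<ge> n \<and> n \<in> {4, 5}) then 1 else 0)"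
    by (simp add: epsilon_def n_def v_def Let_def)
  have lev: "local_level N m 2 = min (n div 2) (if n \<le> v + 2 then 3 else min v (n + 1 - v))"
    by (simp add: local_level_def n_def v_def Let_def)
  have ns: "n \<ge> 6 \<or> n = 2 \<or> n = 3 \<or> n = 4 \<or> n = 5" using n by linarith
  consider "v \<ge> n" | "v + 1 = n" | "v + 2 = n" | "v + 3 \<le> n" by linarith
  then show ?thesis unfolding n1 th eps lev n_def[symmetric] v_def[symmetric]
  proof cases
    case 1
    with ns n v show "int (min (n div 2) (if n \<le> v + 2 then 3 else min v (n + 1 - v))) =
      max 1 (min (int v) (int (n + 1) - int v)) +
      (int (if n \<le> v \<and> 6 \<le> n then 2 else if v + 1 = n \<and> 5 \<le> v \<or> n \<le> v \<and> n \<in> {4, 5} then 1 else 0) -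
       int (if 2 * v = n + 1 then 1 else 0))" by auto
  next
    case 2
    with ns n v show "int (min (n div 2) (if n \<le> v + 2 then 3 else min v (n + 1 - v))) =
      max 1 (min (int v) (int (n + 1) - int v)) +
      (int (if n \<le> v \<and> 6 \<le> n then 2 else if v + 1 = n \<and> 5 \<le> v \<or> n \<le> v \<and> n \<in> {4, 5} then 1 else 0) -
       int (if 2 * v = n + 1 then 1 else 0))" by auto
  next
    case 3
    with ns n v show "int (min (n div 2) (if n \<le> v + 2 then 3 else min v (n + 1 - v))) =
      max 1 (min (int v) (int (n + 1) - int v)) +
      (int (if n \<le> v \<and> 6 \<le> n then 2 else if v + 1 = n \<and> 5 \<le> v \<or> n \<le> v \<and> n \<in> {4, 5} then 1 else 0) -
       int (if 2 * v = n + 1 then 1 else 0))" by auto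
  next
    case 4
    then have c: "\<not> n \<le> v + 2" "\<not> n \<le> v" "v + 1 \<noteq> n" "int (n + 1) - int v = int (n + 1 - v)" by auto
    have "max (1::int) (min (int v) (int (n + 1 - v))) = int (min v (n + 1 - v))"
      using 4 v by simp
    moreover have "min (n div 2) (min v (n + 1 - v)) + (if 2 * v = n + 1 then 1 else 0) = min v (n + 1 - v)"
      using 4 v by (auto simp: min_def)
    ultimately show "int (min (n div 2) (if n \<le> v + 2 then 3 else min v (n + 1 - v))) =
      max 1 (min (int v) (int (n + 1) - int v)) +
      (int (if n \<le> v \<and> 6 \<le> n then 2 else if v + 1 = n \<and> 5 \<le> v \<or> n \<le> v \<and> n \<in> {4, 5} then 1 else 0) -
       int (if 2 * v = n + 1 then 1 else 0))" using c by (auto split: if_splits)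
  qed
qed

lemma sigma_level_eq:
  assumes N: "N > 0" and m: "m > 0"
  shows "sigma_level N m = of_nat (\<Prod>p\<in>level_primes N m. p ^ local_level N m p)"
proof -
  define adj where "adj = int (epsilon N m) - int (min (theta N m) (multiplicity 2 (square_part N)))"
  define ex where "ex p = max 1 (min (int (multiplicity p m))
                     (int (multiplicity p (2 * N)) - int (multiplicity p m)))" for p
  \<comment> \<open>The power of 2 outside the product must be trivial when 2 is not among its
    primes. For odd m none of the defining conditions holds; for n < 2 the minimum with the exponent
    of 2 in s, which is 0, removes theta.\<close>
  have adj0: "adj = 0" if "2 \<notin> level_primes N m"
  proof -
    have "odd m \<or> multiplicity 2 N < 2"
      using that prime_dvd_square_part_iff[of 2 N] N gcd_le1_nat[of 1 m] by (auto simp: level_primes_def)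
    then show ?thesis
    proof
      assume "odd m"
      then have "multiplicity 2 m = 0" by (rule not_dvd_imp_multiplicity_0)
      then show ?thesis by (auto simp: adj_def epsilon_def theta_def Let_def)
    next
      assume "multiplicity 2 N < 2"
      then show ?thesis by (auto simp: adj_def epsilon_def Let_def prime_multiplicity_square_part)
    qed
  qed
  have "sigma_level N m = (\<Prod>p\<in>level_primes N m. of_nat p powi ex p) * 2 powi adj"
    by (simp add: sigma_level_def level_primes_def ex_def adj_def)
  also have "2 powi adj = (\<Prod>p\<in>level_primes N m. if p = 2 then 2 powi adj else (1::rat))"
    using adj0 finite_level_primes[OF m] by (simp add: prod.delta)
  also have "(\<Prod>p\<in>level_primes N m. of_nat p powi ex p) * \<dots>
      = (\<Prod>p\<in>level_primes N m. of_nat p powi ex p * (if p = 2 then 2 powi adj else 1))"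
    by (simp add: prod.distrib)
  also have "\<dots> = (\<Prod>p\<in>level_primes N m. of_nat (p ^ local_level N m p))"
  proof (rule prod.cong)
    fix p assume p: "p \<in> level_primes N m"
    note D = level_primesD[OF p N m]
    show "of_nat p powi ex p * (if p = 2 then 2 powi adj else 1) = rat_of_nat (p ^ local_level N m p)"
    proof (cases "p = 2")
      case True
      have "int (local_level N m 2) = ex 2 + adj"
        unfolding ex_def adj_def using D True N by (intro local_level_two) auto
      then have "(2::rat) powi (ex 2 + adj) = 2 ^ local_level N m 2" by (metis power_int_of_nat)
      then show ?thesis using True by (simp add: power_int_add)
    next
      case False
      have "\<not> p dvd 2" using D(1) False primes_dvd_imp_eq two_is_prime_nat by blast
      then have "multiplicity p (2 * N) = multiplicity p N"
        using D(1) N by (simp add: prime_elem_multiplicity_mult_distrib prime_imp_prime_elem not_dvd_imp_multiplicity_0)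
      then have "ex p = int (local_level N m p)"
        using D(5) False by (auto simp: ex_def local_level_def Let_def)
      then show ?thesis using False by simp
    qed
  qed simp
  finally show ?thesis by simp
qed

section \<open>Matrices and conjugation\<close>

text \<open>The library's normalizer is a stabilizer for conjugation of subsets, hence an equality
  of sets. Both inclusions are kept because for infinite H one does not imply the other.\<close>

lemma (in group) normalizer_iff:
  assumes H: "H \<subseteq> carrier G"
  shows "g \<in> normalizer G H \<longleftrightarrow> g \<in> carrier G \<and>
    (\<forall>h\<in>H. g \<otimes> h \<otimes> inv g \<in> H) \<and> (\<forall>h\<in>H. inv g \<otimes> h \<otimes> g \<in> H)"
proof -
  have *: "g <# H #> inv g = (\<lambda>h. g \<otimes> h \<otimes> inv g) ` H" for g
    by (auto simp: l_coset_def r_coset_def)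
  have "(\<lambda>h. g \<otimes> h \<otimes> inv g) ` H = H \<longleftrightarrow>
      (\<forall>h\<in>H. g \<otimes> h \<otimes> inv g \<in> H) \<and> (\<forall>h\<in>H. inv g \<otimes> h \<otimes> g \<in> H)"
    if g: "g \<in> carrier G"
  proof -
    have 1: "inv g \<otimes> (g \<otimes> h \<otimes> inv g) \<otimes> g = h" "g \<otimes> (inv g \<otimes> h \<otimes> g) \<otimes> inv g = h" if "h \<in> H" for h
    proof -
      have h: "h \<in> carrier G" using H that by blast
      show "inv g \<otimes> (g \<otimes> h \<otimes> inv g) \<otimes> g = h" using g h by (metis inv_closed inv_solve_right inv_solve_left m_assoc m_closed)
      show "g \<otimes> (inv g \<otimes> h \<otimes> g) \<otimes> inv g = h" using g h by (metis inv_closed inv_solve_right inv_solve_left m_assoc m_closed)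
    qed
    show ?thesis
    proof (intro iffI conjI ballI equalityI subsetI)
      fix h assume eq: "(\<lambda>h. g \<otimes> h \<otimes> inv g) ` H = H" and h: "h \<in> H"
      then show "g \<otimes> h \<otimes> inv g \<in> H" by blast
      obtain h' where "h' \<in> H" "h = g \<otimes> h' \<otimes> inv g" using eq h by blast
      then show "inv g \<otimes> h \<otimes> g \<in> H" using 1 by simp
    next
      fix h assume *: "(\<forall>h\<in>H. g \<otimes> h \<otimes> inv g \<in> H) \<and> (\<forall>h\<in>H. inv g \<otimes> h \<otimes> g \<in> H)"
      { assume "h \<in> H"
        then show "h \<in> (\<lambda>h. g \<otimes> h \<otimes> inv g) ` H"
          using * 1(2)[of h] by (intro image_eqI[of _ _ "inv g \<otimes> h \<otimes> g"]) auto }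
      assume "h \<in> (\<lambda>h. g \<otimes> h \<otimes> inv g) ` H"
      then show "h \<in> H" using * by blast
    qed
  qed
  then show ?thesis using H by (auto simp: normalizer_def stabilizer_def *)
qed

lemma mat2_nth [simp]:
  "mat2 a b c d $ 1 $ 1 = a" "mat2 a b c d $ 1 $ 2 = b"
  "mat2 a b c d $ 2 $ 1 = c" "mat2 a b c d $ 2 $ 2 = d"
  by (simp_all add: mat2_def)

lemma mat2_eq_iff: "mat2 a b c d = mat2 a' b' c' d' \<longleftrightarrow> a = a' \<and> b = b' \<and> c = c' \<and> d = d'"
  by (metis mat2_nth)

lemma mat2_eta: "A = mat2 (A $ 1 $ 1) (A $ 1 $ 2) (A $ 2 $ 1) (A $ 2 $ 2)"
  by (simp add: vec_eq_iff forall_2)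

lemma mat2_mult:
  "mat2 a b c d ** mat2 a' b' c' d' = mat2 (a * a' + b * c') (a * b' + b * d') (c * a' + d * c') (c * b' + d * d')"
  by (simp add: vec_eq_iff forall_2 matrix_matrix_mult_def sum_2)

lemma mat2_one: "mat 1 = mat2 1 0 0 1"
  by (simp add: vec_eq_iff forall_2 mat_def)

lemma mat2_SL2R: "mat2 a b c d \<in> carrier SL2R \<longleftrightarrow> a * d - b * c = 1"
  by (simp add: SL2R_def det_2)

lemma inv_mat2:
  assumes "a * d - b * c = 1"
  shows "inv\<^bsub>SL2R\<^esub> (mat2 a b c d) = mat2 d (- b) (- c) a"
proof -
  interpret group SL2R by (rule group_SL2R)
  show ?thesis
    using assms by (intro inv_equality) (auto simp: mat2_SL2R, auto simp: SL2R_def mat2_mult mat2_one mat2_eq_iff algebra_simps)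
qed

text \<open>
  A presentation \<open>(\<mu>, a, b, c, d)\<close> is \<open>scaled_mat\<close> with \<open>x = a s\<^sub>\<mu>\<close>, \<open>w = d s\<^sub>\<mu>\<close>, \<open>y = b s\<^sub>\<nu>\<close>, \<open>z = c s\<^sub>\<nu>\<close>
  for \<open>\<nu> = N / \<mu>\<close>, and \<open>t\<close>, \<open>t'\<close> the square-free parts of \<open>\<mu>\<close> and \<open>\<nu>\<close>. In this form the choice of \<open>\<mu>\<close>
  at the primes of even exponent in \<open>N\<close> is no longer visible.
\<close>

definition scaled_mat :: "nat \<Rightarrow> nat \<Rightarrow> nat \<Rightarrow> int \<Rightarrow> int \<Rightarrow> int \<Rightarrow> int \<Rightarrow> real^2^2" where
  "scaled_mat s t t' x y z w = mat2 (x * sqrt t) (y / (s * sqrt t)) (z * s * t' * sqrt t) (w * sqrt t)"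

lemma Gamma1_torsion_iff:
  assumes m: "m > 0"
  shows "A \<in> Gamma1_torsion m N \<longleftrightarrow> (\<exists>(e::int) (f::int) (g::int) (h::int). A = mat2 (of_int e) (of_int f) (of_int (N * g)) (of_int h) \<and>
      e * h - N * f * g = 1 \<and> int N dvd e ^ m - 1 \<and> int N dvd h ^ m - 1)"
proof
  assume "A \<in> Gamma1_torsion m N"
  then obtain a b c d a' d' :: int where A: "A = mat2 (of_int a) (of_int b) (of_int c) (of_int d)"
    "a * d - b * c = 1" "int N dvd c" and "A $ 1 $ 1 = of_int a'" "A $ 2 $ 2 = of_int d'"
    "a' \<in> unit_torsion m N" "d' \<in> unit_torsion m N"
    by (auto simp: Gamma1_torsion_def Gamma0_def)
  then have "int N dvd a ^ m - 1" "int N dvd d ^ m - 1" using m by (auto simp: unit_torsion_iff)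
  moreover obtain g where "c = int N * g" using A by blast
  ultimately show "\<exists>(e::int) (f::int) (g::int) (h::int). A = mat2 (of_int e) (of_int f) (of_int (N * g)) (of_int h) \<and>
      e * h - N * f * g = 1 \<and> int N dvd e ^ m - 1 \<and> int N dvd h ^ m - 1"
    using A by (intro exI[of _ a] exI[of _ b] exI[of _ g] exI[of _ d]) (auto simp: mult_ac)
next
  assume "\<exists>(e::int) (f::int) (g::int) (h::int). A = mat2 (of_int e) (of_int f) (of_int (N * g)) (of_int h) \<and>
      e * h - N * f * g = 1 \<and> int N dvd e ^ m - 1 \<and> int N dvd h ^ m - 1"
  then obtain e f g h :: int where A: "A = mat2 (of_int e) (of_int f) (of_int (N * g)) (of_int h)"
      "e * h - N * f * g = 1" "int N dvd e ^ m - 1" "int N dvd h ^ m - 1" by blast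
  have "A \<in> Gamma0 N" unfolding Gamma0_def
  proof (intro CollectI exI conjI)
    show "e * h - f * (N * g) = 1" using A(2) by (simp add: mult_ac)
  qed (use A(1) in auto)
  then show "A \<in> Gamma1_torsion m N"
    using A m by (auto simp: Gamma1_torsion_def unit_torsion_iff)
qed

text \<open>Here r stands for sqrt t and q for 1 / (s r), tied by sqr = 1 alone. The lower left
  identity is formal; each of the others has a difference of sides that is a polynomial multiple of
  sqr - 1.\<close>

lemma conj_scaled_identities:
  fixes r q s t' x y z w e f g h :: real
  assumes "s * (q * r) = 1"
  defines "N \<equiv> s * s * (r * r) * t'"
  shows "(x * r * e + y * q * (N * g)) * (w * r) + (x * r * f + y * q * h) * (- z * s * t' * r) =
      x * w * (r * r) * e - y * z * t' * h + s * (r * r) * t' * (y * w * g - x * z * f)"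
    and "(x * r * e + y * q * (N * g)) * (- y * q) + (x * r * f + y * q * h) * (x * r) =
      x\<^sup>2 * (r * r) * f - y\<^sup>2 * t' * g + x * y * (h - e) * (q * r)"
    and "(z * s * t' * r * e + w * r * (N * g)) * (w * r) + (z * s * t' * r * f + w * r * h) * (- z * s * t' * r) =
      z * w * (e - h) * (s * (r * r) * t') + N * (w\<^sup>2 * (r * r) * g - z\<^sup>2 * t' * f)"
    and "(z * s * t' * r * e + w * r * (N * g)) * (- y * q) + (z * s * t' * r * f + w * r * h) * (x * r) =
      x * w * (r * r) * h - y * z * t' * e - s * (r * r) * t' * (y * w * g - x * z * f)"
proof -
  define k where "k = s * (q * r)"
  have k: "k - 1 = 0" using assms(1) by (simp add: k_def)
  have "(x * r * e + y * q * (N * g)) * (w * r) + (x * r * f + y * q * h) * (- z * s * t' * r)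
      - (x * w * (r * r) * e - y * z * t' * h + s * (r * r) * t' * (y * w * g - x * z * f))
      = (k - 1) * (y * w * g * s * (r * r) * t' - y * z * t' * h)"
    unfolding k_def N_def by (simp add: algebra_simps)
  then show "(x * r * e + y * q * (N * g)) * (w * r) + (x * r * f + y * q * h) * (- z * s * t' * r) =
      x * w * (r * r) * e - y * z * t' * h + s * (r * r) * t' * (y * w * g - x * z * f)"
    unfolding k by simp
  have "(x * r * e + y * q * (N * g)) * (- y * q) + (x * r * f + y * q * h) * (x * r)
      - (x\<^sup>2 * (r * r) * f - y\<^sup>2 * t' * g + x * y * (h - e) * (q * r))
      = (k - 1) * (- (k + 1) * y\<^sup>2 * t' * g)"
    unfolding k_def N_def by (simp add: algebra_simps power2_eq_square)
  then show "(x * r * e + y * q * (N * g)) * (- y * q) + (x * r * f + y * q * h) * (x * r) =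
      x\<^sup>2 * (r * r) * f - y\<^sup>2 * t' * g + x * y * (h - e) * (q * r)"
    unfolding k by simp
  show "(z * s * t' * r * e + w * r * (N * g)) * (w * r) + (z * s * t' * r * f + w * r * h) * (- z * s * t' * r) =
      z * w * (e - h) * (s * (r * r) * t') + N * (w\<^sup>2 * (r * r) * g - z\<^sup>2 * t' * f)"
    unfolding N_def by (simp add: algebra_simps power2_eq_square)
  have "(z * s * t' * r * e + w * r * (N * g)) * (- y * q) + (z * s * t' * r * f + w * r * h) * (x * r)
      - (x * w * (r * r) * h - y * z * t' * e - s * (r * r) * t' * (y * w * g - x * z * f))
      = (k - 1) * (- y * z * t' * e - y * w * g * s * (r * r) * t')"
    unfolding k_def N_def by (simp add: algebra_simps)
  then show "(z * s * t' * r * e + w * r * (N * g)) * (- y * q) + (z * s * t' * r * f + w * r * h) * (x * r) =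
      x * w * (r * r) * h - y * z * t' * e - s * (r * r) * t' * (y * w * g - x * z * f)"
    unfolding k by simp
qed

text \<open>The entries show where the two off-diagonal conditions arise: the upper right one is
  integral iff s divides xy(h - e), and, as N = s * (s t t'), the lower left one is a multiple of N
  iff s divides zw(h - e).\<close>

lemma conj_scaled_mat:
  fixes e f g h x y z w :: int and N s t t' :: nat
  assumes nz: "s > 0" "t > 0" and Nt: "N = s\<^sup>2 * (t * t')"
  defines "A \<equiv> scaled_mat s t t' x y z w" and "A' \<equiv> scaled_mat s t t' w (- y) (- z) x"
  shows "A ** mat2 e f (of_int (N * g)) h ** A' =
    mat2 (of_int (x * w * t * e - y * z * t' * h + int (s * t * t') * (y * w * g - x * z * f)))
      (of_int (x\<^sup>2 * t * f - y\<^sup>2 * t' * g) + of_int (x * y * (h - e)) / s)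
      (of_int (z * w * (e - h) * int (s * t * t') + N * (w\<^sup>2 * t * g - z\<^sup>2 * t' * f)))
      (of_int (x * w * t * h - y * z * t' * e - int (s * t * t') * (y * w * g - x * z * f)))"
proof -
  define r where "r = sqrt (real t)"
  define q where "q = 1 / (real s * r)"
  define u where "u = 1 / real s"
  have r: "r * r = real t" "r \<noteq> 0" using nz by (auto simp: r_def)
  have su: "real s * u = 1" and q: "q * r = u" using nz r by (auto simp: u_def q_def)
  have N: "real N = real s * real s * real t * real t'" by (subst Nt) (simp add: power2_eq_square)
  have A: "A = mat2 (x * r) (y * q) (z * s * t' * r) (w * r)"
    and A': "A' = mat2 (w * r) (- y * q) (- z * s * t' * r) (x * r)"
    by (simp_all add: A_def A'_def scaled_mat_def r_def q_def)
  have u: "of_int (x * y * (h - e)) / s = of_int (x * y * (h - e)) * u" by (simp add: u_def)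
  have sqr: "real s * (q * r) = 1" using q su by simp
  show ?thesis unfolding A A' mat2_mult mat2_eq_iff u
    unfolding of_int_mult of_int_add of_int_diff of_int_of_nat_eq of_int_power of_int_minus of_nat_mult N
    unfolding r(1)[symmetric] q[symmetric]
    by (intro conjI conj_scaled_identities[OF sqr])
qed

section \<open>Square-free parts and denominators\<close>

text \<open>For q = a/b in lowest terms b^2 divides the square-free number, so b = 1.\<close>

lemma rational_times_sqrt_squarefree:
  fixes q :: real and \<tau> :: nat
  assumes q: "q \<in> \<rat>" and \<tau>: "squarefree \<tau>" and int: "q\<^sup>2 * \<tau> \<in> \<int>"
  shows "q \<in> \<int>"
proof -
  obtain r where r: "q = of_rat r" using q by (auto simp: Rats_def)
  obtain a b where ab: "quotient_of r = (a, b)" by (cases "quotient_of r")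
  have b: "b > 0" using ab by (rule quotient_of_denom_pos)
  have cop: "coprime a b" using ab by (rule quotient_of_coprime)
  have "r = of_int a / of_int b" using ab by (rule quotient_of_div)
  then have qab: "q = of_int a / of_int b" by (simp add: r of_rat_divide)
  obtain k where k: "q\<^sup>2 * \<tau> = of_int k" using int by (auto elim: Ints_cases)
  have "of_int (a\<^sup>2 * int \<tau>) = (of_int (k * b\<^sup>2) :: real)"
    using k b by (simp add: qab field_simps)
  then have "a\<^sup>2 * int \<tau> = k * b\<^sup>2" by (simp only: of_int_eq_iff)
  then have "b\<^sup>2 dvd a\<^sup>2 * int \<tau>" by simp
  then have "b\<^sup>2 dvd int \<tau>" using cop by (simp add: coprime_dvd_mult_right_iff coprime_commute)
  moreover have "b\<^sup>2 = int ((nat b)\<^sup>2)" using b by simp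
  ultimately have "(nat b)\<^sup>2 dvd \<tau>" by (simp only: int_dvd_int_iff)
  then have "nat b dvd 1" using \<tau> by (rule squarefreeD[rotated])
  then have "b = 1" using b by simp
  then show ?thesis by (simp add: qab)
qed

lemma squarefree_scaled_dvd:
  fixes c s :: int and \<tau> :: nat
  assumes "squarefree \<tau>" "s\<^sup>2 dvd c\<^sup>2 * int \<tau>" "s \<noteq> 0"
  shows "s dvd c"
proof -
  obtain k where k: "c\<^sup>2 * int \<tau> = s\<^sup>2 * k" using assms by blast
  have "real_of_int (c\<^sup>2 * int \<tau>) = of_int (s\<^sup>2 * k)" by (simp only: k)
  then have "(real_of_int c / real_of_int s)\<^sup>2 * \<tau> = of_int k"
    using assms(3) by (simp add: power_divide field_simps)
  then have "real_of_int c / real_of_int s \<in> \<int>"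
    by (intro rational_times_sqrt_squarefree[OF Rats_divide[OF Rats_of_int Rats_of_int] assms(1)]) simp
  then obtain j where "real_of_int c / real_of_int s = of_int j" by (auto elim: Ints_cases)
  then have "real_of_int c = of_int (s * j)" using assms by (simp add: field_simps)
  then have "c = s * j" by (simp only: of_int_eq_iff)
  then show ?thesis by simp
qed

lemma squarefree_dvd_of_dvd_square:
  fixes c :: int and t :: nat
  assumes t: "squarefree t" and dvd: "int t dvd c\<^sup>2"
  shows "int t dvd c"
proof -
  have "(int t)\<^sup>2 dvd c\<^sup>2 * int t" 
    unfolding power2_eq_square[of "int t"] by (rule mult_dvd_mono[OF dvd dvd_refl])
  moreover have "int t \<noteq> 0" using t by (cases "t = 0") auto
  ultimately show ?thesis by (rule squarefree_scaled_dvd[OF t])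
qed

text \<open>Halving exponents with rounding is additive here because at each prime one of the two
  exponents is 0.\<close>

lemma square_part_mult_coprime:
  fixes a b :: nat
  assumes "coprime a b" "a > 0" "b > 0"
  shows "square_part (a * b) = square_part a * square_part b"
proof -
  have "normalize (square_part (a * b)) = normalize (square_part a * square_part b)"
  proof (rule multiplicity_eq_imp_eq)
    fix p :: nat assume p: "prime p"
    have pe: "prime_elem p" using p by (rule prime_imp_prime_elem)
    have nz: "a \<noteq> 0" "b \<noteq> 0" "square_part a \<noteq> 0" "square_part b \<noteq> 0" using assms by simp_all
    have "\<not> (p dvd a \<and> p dvd b)"
      using coprime_common_divisor[OF assms(1), of p] prime_gt_1_nat[OF p] by auto
    then have disj: "multiplicity p a = 0 \<or> multiplicity p b = 0"
      using not_dvd_imp_multiplicity_0[of p a] not_dvd_imp_multiplicity_0[of p b] by argo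
    have "multiplicity p (square_part (a * b)) = (multiplicity p a + multiplicity p b) div 2"
      by (simp only: prime_multiplicity_square_part[OF p] prime_elem_multiplicity_mult_distrib[OF pe nz(1,2)])
    also have "\<dots> = multiplicity p a div 2 + multiplicity p b div 2"
      using disj by (elim disjE) simp_all
    also have "\<dots> = multiplicity p (square_part a * square_part b)"
      by (simp only: prime_multiplicity_square_part[OF p] prime_elem_multiplicity_mult_distrib[OF pe nz(3,4)])
    finally show "multiplicity p (square_part (a * b)) = multiplicity p (square_part a * square_part b)" .
  qed (use assms in auto)
  then show ?thesis by simp
qed

section \<open>Cancelation in products of fractions\<close>

lemma no_cancel_coprime:
  assumes "coprime a1 b1" "coprime a1 b2" "coprime a2 b1" "coprime a2 b2" "b1 > 0" "b2 > 0"
  shows "no_cancel (of_int a1 / of_int b1) (of_int a2 / of_int b2)"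
proof -
  have *: "denom (of_int a / of_int b) = b" if "coprime a b" "b > 0" for a b
  proof -
    have "quotient_of (of_int a / of_int b) = (a, b)"
      using that by (simp flip: Fract_of_int_quotient add: quotient_of_Fract Rat.normalize_def)
    then show ?thesis by (simp add: denom_def)
  qed
  have "of_int a1 / of_int b1 * (of_int a2 / of_int b2) = (of_int (a1 * a2) / of_int (b1 * b2) :: rat)"
    by simp
  moreover have "coprime (a1 * a2) (b1 * b2)" using assms by simp
  ultimately show ?thesis unfolding no_cancel_def using assms *[of "a1 * a2" "b1 * b2"] * by simp
qed

text \<open>The fractions may be reducible: coprimality of each numerator to the other denominator
  survives the reduction.\<close>

lemma no_cancel_divide:
  fixes x y :: int and s1 s2 :: nat
  assumes "coprime x (int s2)" "coprime y (int s1)" "coprime s1 s2" "s1 > 0" "s2 > 0"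
  shows "no_cancel (of_int x / of_nat s1) (of_int y / of_nat s2)"
proof -
  define g1 where "g1 = gcd x (int s1)"
  define g2 where "g2 = gcd y (int s2)"
  have g: "g1 > 0" "g2 > 0" using assms by (auto simp: g1_def g2_def gcd_pos_int)
  obtain x' b1 where 1: "x = g1 * x'" "int s1 = g1 * b1" using gcd_dvd1[of x "int s1"] gcd_dvd2[of x "int s1"] unfolding g1_def[symmetric] by (elim dvdE)
  obtain y' b2 where 2: "y = g2 * y'" "int s2 = g2 * b2" using gcd_dvd1[of y "int s2"] gcd_dvd2[of y "int s2"] unfolding g2_def[symmetric] by (elim dvdE)
  have b: "b1 > 0" "b2 > 0" 
    using zero_less_mult_pos[of g1 b1] zero_less_mult_pos[of g2 b2] 1 2 g assms by simp_all
  have "gcd (g1 * x') (g1 * b1) = g1" unfolding 1[symmetric] by (simp only: g1_def)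
  then have "coprime x' b1" using g by (simp add: coprime_iff_gcd_eq_1 flip: gcd_mult_distrib_int)
  moreover have "gcd (g2 * y') (g2 * b2) = g2" unfolding 2[symmetric] by (simp only: g2_def)
  then have "coprime y' b2" using g by (simp add: coprime_iff_gcd_eq_1 flip: gcd_mult_distrib_int)
  moreover have "coprime x' b2" "coprime y' b1" using assms(1,2) unfolding 1(1) 2(1) 1(2) 2(2) by simp_all
  ultimately have "no_cancel (of_int x' / of_int b1) (of_int y' / of_int b2)"
    using b by (intro no_cancel_coprime) auto
  moreover have "(of_int x / of_nat s1 :: rat) = of_int x' / of_int b1"
  proof -
    have "(of_nat s1 :: rat) = of_int (int s1)" by simp
    then show ?thesis using g unfolding 1 by simp
  qed
  moreover have "(of_int y / of_nat s2 :: rat) = of_int y' / of_int b2"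
  proof -
    have "(of_nat s2 :: rat) = of_int (int s2)" by simp
    then show ?thesis using g unfolding 2 by simp
  qed
  ultimately show ?thesis by simp
qed

lemma frac_ints_divide_iff:
  fixes x :: int and r \<sigma> :: nat
  assumes "r > 0" "\<sigma> > 0"
  shows "of_int x / of_nat r \<in> frac_ints \<sigma> \<longleftrightarrow> int r dvd \<sigma> * x"
proof
  assume "of_int x / of_nat r \<in> frac_ints \<sigma>"
  then obtain k :: int where "(of_int x / of_nat r :: rat) = of_int k / of_nat \<sigma>" by (auto simp: frac_ints_def)
  then have "(of_int (\<sigma> * x) :: rat) = of_int (int r * k)" using assms by (simp add: field_simps)
  then show "int r dvd \<sigma> * x" by (simp only: of_int_eq_iff dvd_triv_left)
next
  assume "int r dvd \<sigma> * x"
  then obtain k where "\<sigma> * x = int r * k" by blast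
  then have "(of_int (\<sigma> * x) :: rat) = of_int (int r * k)" by simp
  then have "(of_int x / of_nat r :: rat) = of_int k / of_nat \<sigma>" using assms by (simp add: field_simps)
  then show "of_int x / of_nat r \<in> frac_ints \<sigma>" by (auto simp: frac_ints_def)
qed

section \<open>Conjugating the torsion group\<close>

lemma Gamma1_torsion_subset:
  assumes "m > 0" shows "Gamma1_torsion m N \<subseteq> carrier SL2R"
proof
  fix A assume "A \<in> Gamma1_torsion m N"
  then obtain e f g h :: int where A: "A = mat2 (of_int e) (of_int f) (of_int (N * g)) (of_int h)"
    "e * h - N * f * g = 1" unfolding Gamma1_torsion_iff[OF assms] by blast
  have "real_of_int (e * h - N * f * g) = 1" using A(2) by simp
  then show "A \<in> carrier SL2R" unfolding A(1) mat2_SL2R by (simp add: algebra_simps)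
qed

lemma of_int_divide_eq_imp_dvd:
  fixes a k :: int and s :: nat
  assumes "real_of_int a / real s = of_int k" "s > 0"
  shows "int s dvd a"
proof -
  have "real_of_int a = of_int (int s * k)" using assms by (simp add: field_simps)
  then have "a = int s * k" by (simp only: of_int_eq_iff)
  then show ?thesis by simp
qed

lemma scaled_mat_SL2R:
  fixes x y z w :: int and s t t' :: nat
  assumes "s > 0" "t > 0"
  shows "scaled_mat s t t' x y z w \<in> carrier SL2R \<longleftrightarrow> x * w * t - y * z * t' = 1"
proof -
  have "real_of_int x * sqrt t * (real_of_int w * sqrt t)
      - real_of_int y / (real s * sqrt t) * (real_of_int z * real s * real t' * sqrt t)
      = of_int (x * w * t - y * z * t')"
    using assms by (simp add: field_simps)
  then show ?thesis unfolding scaled_mat_def mat2_SL2R of_int_mult of_int_of_nat_eq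
    by (simp only: of_int_eq_1_iff of_int_mult of_int_of_nat_eq)
qed

lemma inv_scaled_mat:
  fixes x y z w :: int and s t t' :: nat
  assumes "s > 0" "t > 0" "x * w * t - y * z * t' = 1"
  shows "inv\<^bsub>SL2R\<^esub> (scaled_mat s t t' x y z w) = scaled_mat s t t' w (- y) (- z) x"
  using scaled_mat_SL2R[OF assms(1,2), where x = x and y = y and z = z and w = w and t' = t'] assms(3) unfolding scaled_mat_def mat2_SL2R
  by (subst inv_mat2) (simp_all add: mat2_eq_iff)

context torsion_level
begin

lemma decomposition_pos:
  assumes "N = s\<^sup>2 * (t * t')" shows "t > 0" "t' > 0"
  using N assms by (auto intro: Nat.gr0I)

lemma scaled_mat_conj_mem:
  fixes x y z w :: int and t t' :: nat
  assumes det: "x * w * t - y * z * t' = 1" and Nt: "N = s\<^sup>2 * (t * t')"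
    and xz: "int s dvd \<sigma> * (x * z)" and yw: "int s dvd \<sigma> * (y * w)"
    and xy: "int s dvd \<sigma> * (x * y)" and zw: "int s dvd \<sigma> * (z * w)"
    and B: "B \<in> Gamma1_torsion m N"
  shows "scaled_mat s t t' x y z w ** B ** scaled_mat s t t' w (- y) (- z) x \<in> Gamma1_torsion m N"
    (is "?A ** B ** ?A' \<in> _")
proof -
  note t = decomposition_pos[OF Nt]
  obtain e f g h :: int where B': "B = mat2 (of_int e) (of_int f) (of_int (N * g)) (of_int h)"
    and eh: "e * h - N * f * g = 1" and e: "int N dvd e ^ m - 1" and h: "int N dvd h ^ m - 1"
    using B unfolding Gamma1_torsion_iff[OF m] by blast
  have "e * h - 1 = int N * (f * g)" using eh by (simp add: algebra_simps)
  then have "int \<sigma> dvd h - e" by (intro level_dvd_diff[OF e]) simp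
  then obtain k where k: "h - e = int \<sigma> * k" by blast
  have dvd: "int s dvd a * (h - e)" if "int s dvd \<sigma> * a" for a :: int
    using dvd_mult2[OF that, of k] unfolding k by (simp only: mult_ac)
  obtain j where j: "x * y * (h - e) = int s * j" using dvd[OF xy] by blast
  obtain l where l: "z * w * (h - e) = int s * l" using dvd[OF zw] by blast
  define P where "P = x * w * t * e - y * z * t' * h + int (s * t * t') * (y * w * g - x * z * f)"
  define Q where "Q = x\<^sup>2 * t * f - y\<^sup>2 * t' * g + j"
  define R where "R = w\<^sup>2 * t * g - z\<^sup>2 * t' * f - l"
  define S where "S = x * w * t * h - y * z * t' * e - int (s * t * t') * (y * w * g - x * z * f)"
  have "int N = int s * int (s * t * t')" by (subst Nt) (simp add: power2_eq_square)
  then have "z * w * (e - h) * int (s * t * t') = - int N * l"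
    using l by (simp add: algebra_simps)
  then have R: "z * w * (e - h) * int (s * t * t') + N * (w\<^sup>2 * t * g - z\<^sup>2 * t' * f) = N * R"
    by (simp add: R_def algebra_simps)
  have eq: "?A ** B ** ?A' = mat2 (of_int P) (of_int Q) (of_int (N * R)) (of_int S)"
    unfolding B' conj_scaled_mat[OF s_pos t(1) Nt] R mat2_eq_iff
    using s_pos N by (simp add: P_def Q_def S_def j)
  have "?A \<in> carrier SL2R" "?A' \<in> carrier SL2R" "B \<in> carrier SL2R"
    using det B Gamma1_torsion_subset[OF m] by (auto simp: scaled_mat_SL2R[OF s_pos t(1)] mult.commute)
  then have "?A ** B ** ?A' \<in> carrier SL2R" by (simp add: SL2R_def det_mul)
  then have "of_int (P * S - Q * (N * R)) = real_of_int 1" unfolding eq mat2_SL2R by simp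
  then have PS: "P * S - N * Q * R = 1" unfolding of_int_eq_iff by (simp add: algebra_simps)
  have "int N dvd P ^ m - 1" unfolding P_def by (rule conj_torsion[OF det Nt xz yw xy zw eh e])
  moreover have "int N dvd S ^ m - 1"
  proof -
    \<comment> \<open>Exchanging e with h and negating f and g swaps the two diagonal entries of the
      conjugate.\<close>
    have "h * e - N * (- f) * (- g) = 1" using eh by (simp add: mult.commute)
    from conj_torsion[OF det Nt xz yw xy zw this h] show ?thesis
      unfolding S_def by (simp add: algebra_simps)
  qed
  ultimately show ?thesis unfolding Gamma1_torsion_iff[OF m] using eq PS by blast
qed

text \<open>Inversion exchanges x with w and negates y and z, which preserves the four conditions;
  so one conjugation lemma yields both inclusions.\<close>

lemma scaled_mat_normalizes:
  fixes x y z w :: int and t t' :: nat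
  assumes det: "x * w * t - y * z * t' = 1" and Nt: "N = s\<^sup>2 * (t * t')"
    and dvd: "int s dvd \<sigma> * (x * z)" "int s dvd \<sigma> * (y * w)"
      "int s dvd \<sigma> * (x * y)" "int s dvd \<sigma> * (z * w)"
  shows "scaled_mat s t t' x y z w \<in> normalizer SL2R (Gamma1_torsion m N)"
proof -
  interpret group SL2R by (rule group_SL2R)
  note t = decomposition_pos[OF Nt]
  have det': "w * x * t - (- y) * (- z) * t' = 1" using det by (simp add: mult.commute)
  have dvd': "int s dvd \<sigma> * (w * - z)" "int s dvd \<sigma> * (- y * x)"
      "int s dvd \<sigma> * (w * - y)" "int s dvd \<sigma> * (- z * x)"
    using dvd by (simp_all add: mult.commute)
  show ?thesis
    unfolding normalizer_iff[OF Gamma1_torsion_subset[OF m]] inv_scaled_mat[OF s_pos t(1) det]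
    using scaled_mat_conj_mem[OF det Nt dvd] scaled_mat_conj_mem[OF det' Nt dvd'] det
    by (auto simp: scaled_mat_SL2R[OF s_pos t(1)]) (auto simp: SL2R_def)
qed

lemma scaled_mat_normalizes_imp:
  fixes x y z w :: int and t t' :: nat
  assumes norm: "scaled_mat s t t' x y z w \<in> normalizer SL2R (Gamma1_torsion m N)"
    and det: "x * w * t - y * z * t' = 1" and Nt: "N = s\<^sup>2 * (t * t')"
  shows "int s dvd \<sigma> * (x * y) \<and> int s dvd \<sigma> * (z * w)"
proof (rule level_necessary[OF det Nt])
  interpret group SL2R by (rule group_SL2R)
  note t = decomposition_pos[OF Nt]
  fix e f g h :: int
  assume eh: "e * h - N * f * g = 1" and e: "int N dvd e ^ m - 1"
  have "e * h - 1 = int N * (f * g)" using eh by (simp add: algebra_simps)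
  then have h: "int N dvd h ^ m - 1" by (intro torsion_inverse[OF e]) simp
  let ?B = "mat2 (of_int e) (of_int f) (of_int (N * g)) (of_int h)"
  have "?B \<in> Gamma1_torsion m N" unfolding Gamma1_torsion_iff[OF m] using eh e h by blast
  then have "scaled_mat s t t' x y z w ** ?B ** scaled_mat s t t' w (- y) (- z) x \<in> Gamma1_torsion m N"
    using norm unfolding normalizer_iff[OF Gamma1_torsion_subset[OF m]] inv_scaled_mat[OF s_pos t(1) det]
    by (auto simp: SL2R_def)
  then obtain P Q R S :: int where
    eq: "scaled_mat s t t' x y z w ** ?B ** scaled_mat s t t' w (- y) (- z) x =
      mat2 (of_int P) (of_int Q) (of_int (N * R)) (of_int S)" and P: "int N dvd P ^ m - 1"
    unfolding Gamma1_torsion_iff[OF m] by blast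
  note entries = eq[unfolded conj_scaled_mat[OF s_pos t(1) Nt] mat2_eq_iff]
  have "x * w * t * e - y * z * t' * h + int (s * t * t') * (y * w * g - x * z * f) = P"
    using entries unfolding of_int_eq_iff by blast
  then have 1: "int N dvd (x * w * t * e - y * z * t' * h + int (s * t * t') * (y * w * g - x * z * f)) ^ m - 1"
    using P by simp
  have "real_of_int (x * y * (h - e)) / s = of_int (Q - (x\<^sup>2 * t * f - y\<^sup>2 * t' * g))"
    using entries by (simp add: algebra_simps)
  then have 2: "int s dvd x * y * (h - e)" using s_pos by (rule of_int_divide_eq_imp_dvd)
  have N_eq: "int N = int s * int (s * t * t')" by (subst Nt) (simp add: power2_eq_square)
  have "z * w * (e - h) * int (s * t * t') + N * (w\<^sup>2 * t * g - z\<^sup>2 * t' * f) = N * R"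
    using entries unfolding of_int_eq_iff by blast
  then have "z * w * (e - h) * int (s * t * t') = int s * (R - (w\<^sup>2 * t * g - z\<^sup>2 * t' * f)) * int (s * t * t')"
    unfolding N_eq by (simp add: algebra_simps)
  then have "z * w * (e - h) = int s * (R - (w\<^sup>2 * t * g - z\<^sup>2 * t' * f))"
    using s_pos t N by (simp only: mult_cancel_right) simp
  then have "int s dvd z * w * (e - h)" by simp
  then have "int s dvd - (z * w * (e - h))" by (simp only: dvd_minus_iff)
  then have 3: "int s dvd z * w * (h - e)" by (simp add: algebra_simps)
  show "int s dvd x * y * (h - e) \<and> int s dvd z * w * (h - e) \<and>
      int N dvd (x * w * t * e - y * z * t' * h + int (s * t * t') * (y * w * g - x * z * f)) ^ m - 1"
    using 1 2 3 by blast
qed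

end

lemma exact_divisor_parts:
  assumes "exact_divisor \<mu> N" "N > 0"
  shows "\<mu> > 0" "N div \<mu> > 0" "\<mu> * (N div \<mu>) = N" "coprime \<mu> (N div \<mu>)"
    "square_part N = square_part \<mu> * square_part (N div \<mu>)"
    "N = (square_part N)\<^sup>2 * (squarefree_part \<mu> * squarefree_part (N div \<mu>))"
proof -
  show 1: "\<mu> * (N div \<mu>) = N" "coprime \<mu> (N div \<mu>)" using assms by (auto simp: exact_divisor_def)
  show 2: "\<mu> > 0" "N div \<mu> > 0" using 1(1) assms(2) by (metis mult_is_0 not_gr0)+
  show 3: "square_part N = square_part \<mu> * square_part (N div \<mu>)"
    using square_part_mult_coprime[OF 1(2) 2] 1(1) by simp
  have "N = (squarefree_part \<mu> * (square_part \<mu>)\<^sup>2) * (squarefree_part (N div \<mu>) * (square_part (N div \<mu>))\<^sup>2)"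
    using 1(1) squarefree_decompose[of \<mu>] squarefree_decompose[of "N div \<mu>"] by simp
  then show "N = (square_part N)\<^sup>2 * (squarefree_part \<mu> * squarefree_part (N div \<mu>))"
    unfolding 3 by (simp add: power_mult_distrib mult_ac)
qed

lemma presentation_scaled_mat:
  fixes x y z w :: int
  assumes \<mu>: "exact_divisor \<mu> N" and N: "N > 0"
  defines "s1 \<equiv> square_part \<mu>" and "s2 \<equiv> square_part (N div \<mu>)"
  shows "mat2 (of_rat (of_int x / of_nat s1) * sqrt \<mu>) (of_rat (of_int y / of_nat s2) / sqrt \<mu>)
     (of_rat (of_int z / of_nat s2) * real (N div \<mu>) * sqrt \<mu>) (of_rat (of_int w / of_nat s1) * sqrt \<mu>)
   = scaled_mat (square_part N) (squarefree_part \<mu>) (squarefree_part (N div \<mu>)) x y z w"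
proof -
  define t1 where "t1 = squarefree_part \<mu>"
  define t2 where "t2 = squarefree_part (N div \<mu>)"
  have s: "s1 > 0" "s2 > 0" using exact_divisor_parts(1,2)[OF \<mu> N] by (auto simp: s1_def s2_def intro: Nat.gr0I)
  have "\<mu> = t1 * s1\<^sup>2" unfolding t1_def s1_def by (rule squarefree_decompose)
  then have "sqrt \<mu> = sqrt (real t1 * (real s1)\<^sup>2)" by simp
  then have \<mu>': "sqrt \<mu> = s1 * sqrt t1" by (simp add: real_sqrt_mult)
  have "N div \<mu> = t2 * s2\<^sup>2" unfolding t2_def s2_def by (rule squarefree_decompose)
  then have N': "real (N div \<mu>) = real t2 * (real s2)\<^sup>2" by simp
  have sN: "real (square_part N) = real s1 * real s2"
    unfolding exact_divisor_parts(5)[OF \<mu> N] s1_def s2_def by simp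
  show ?thesis unfolding scaled_mat_def mat2_eq_iff t1_def[symmetric] t2_def[symmetric] \<mu>' N' sN
    using s by (auto simp: of_rat_divide field_simps power2_eq_square)
qed

section \<open>Presentations\<close>

lemma frac_intsE:
  assumes "q \<in> frac_ints r" obtains k :: int where "q = of_int k / of_nat r"
  using assms by (auto simp: frac_ints_def)

lemma Gamma0_star_imp_scaled_mat:
  assumes A: "A \<in> Gamma0_star \<sigma> N" and N: "N > 0" and \<sigma>: "\<sigma> > 0"
  obtains t t' :: nat and x y z w :: int
  where "A = scaled_mat (square_part N) t t' x y z w" "x * w * t - y * z * t' = 1"
    "N = (square_part N)\<^sup>2 * (t * t')"
    "int (square_part N) dvd \<sigma> * (x * z)" "int (square_part N) dvd \<sigma> * (y * w)"
    "int (square_part N) dvd \<sigma> * (x * y)" "int (square_part N) dvd \<sigma> * (z * w)"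
proof -
  obtain \<mu> a b c d where P: "presentation N \<mu> a b c d A" and fr: "{a, b, c, d} \<subseteq> frac_ints \<sigma>"
    and SL: "A \<in> carrier SL2R"
    using A by (auto simp: Gamma0_star_def Gamma0_star_full_def)
  define s1 where "s1 = square_part \<mu>"
  define s2 where "s2 = square_part (N div \<mu>)"
  have ex: "exact_divisor \<mu> N" using P by (simp add: presentation_def)
  note parts = exact_divisor_parts[OF ex N]
  have s: "s1 > 0" "s2 > 0" "square_part N = s1 * s2" using parts by (auto simp: s1_def s2_def intro: Nat.gr0I)
  have "a \<in> frac_ints s1" "d \<in> frac_ints s1" "b \<in> frac_ints s2" "c \<in> frac_ints s2"
    using P by (simp_all add: presentation_def s1_def s2_def)
  then obtain x y z w :: int where xyzw: "a = of_int x / of_nat s1" "b = of_int y / of_nat s2"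
    "c = of_int z / of_nat s2" "d = of_int w / of_nat s1" by (metis frac_intsE)
  have A_eq: "A = scaled_mat (square_part N) (squarefree_part \<mu>) (squarefree_part (N div \<mu>)) x y z w"
    using P presentation_scaled_mat[OF ex N, of x y z w] unfolding presentation_def xyzw s1_def s2_def by simp
  have dvd: "int s1 dvd \<sigma> * x" "int s2 dvd \<sigma> * y" "int s2 dvd \<sigma> * z" "int s1 dvd \<sigma> * w"
    using fr s \<sigma> unfolding xyzw by (simp_all add: frac_ints_divide_iff)
  have "coprime s1 s2"
    using parts(4) unfolding s1_def s2_def
    by (meson coprime_divisors dvd_power dvd_trans pos2 square_part_square_dvd)
  \<comment> \<open>Each product pairs an entry over s1 with an entry over s2, and s = s1 * s2 with
    coprime factors.\<close>
  have mult: "int (square_part N) dvd \<sigma> * (p * q)"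
    if "int s1 dvd \<sigma> * p" "int s2 dvd \<sigma> * q" for p q :: int
  proof -
    have "int s1 dvd \<sigma> * (p * q)" using dvd_mult2[OF that(1), of q] by (simp only: mult_ac)
    moreover have "int s2 dvd \<sigma> * (p * q)" using dvd_mult2[OF that(2), of p] by (simp only: mult_ac)
    ultimately show ?thesis unfolding s(3) of_nat_mult using \<open>coprime s1 s2\<close> by (intro divides_mult) auto
  qed
  have "x * w * squarefree_part \<mu> - y * z * squarefree_part (N div \<mu>) = 1"
    using SL scaled_mat_SL2R[of "square_part N" "squarefree_part \<mu>"] N unfolding A_eq
    by (simp add: neq0_conv[symmetric] del: neq0_conv)
  then show thesis
    using that[OF A_eq _ parts(6)] mult[OF dvd(1,3)] mult[OF dvd(4,2)] mult[OF dvd(1,2)] mult[OF dvd(4,3)]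
    by (simp add: mult.commute)
qed

lemma coprime_int_by_primes:
  fixes a :: nat and b :: int
  assumes "\<And>p. prime p \<Longrightarrow> p dvd a \<Longrightarrow> int p dvd b \<Longrightarrow> False"
  shows "coprime (int a) b"
proof (rule ccontr)
  assume "\<not> coprime (int a) b"
  then have "\<not> coprime a (nat \<bar>b\<bar>)"
    by (metis coprime_abs_right_iff coprime_int_iff nat_0_le abs_ge_zero)
  then have "gcd a (nat \<bar>b\<bar>) \<noteq> 1" by (simp add: coprime_iff_gcd_eq_1)
  then obtain p where p: "prime p" "p dvd gcd a (nat \<bar>b\<bar>)" using prime_factor_nat by blast
  have "p dvd a" by (rule dvd_trans[OF p(2) gcd_dvd1])
  moreover have "int p dvd b"
    using dvd_trans[OF p(2) gcd_dvd2] unfolding dvd_nat_abs_iff .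
  ultimately
  show False using assms p(1) by blast
qed

text \<open>
  With \<open>c = x w t\<close> and \<open>d = y z t'\<close> this produces the \<open>\<mu>\<close> of a cancelation-free presentation.
\<close>

lemma exists_adapted_exact_divisor:
  fixes c d :: int
  assumes N: "N > 0" and cd: "c - d = 1"
  obtains \<mu> where "exact_divisor \<mu> N" "coprime (int \<mu>) d" "coprime (int (N div \<mu>)) c"
proof -
  define C where "C = nat \<bar>c\<bar>"
  \<comment> \<open>This gcd collects the full p-part of N for every prime p dividing c; the
    exponent N is large enough since the exponent of p in N is below N.\<close>
  define \<mu> where "\<mu> = gcd N (C ^ N)"
  have \<mu>N: "\<mu> * (N div \<mu>) = N" by (simp add: \<mu>_def)
  have C: "p dvd C \<longleftrightarrow> int p dvd c" for p by (simp add: C_def dvd_nat_abs_iff)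
  have in\<mu>: "int p dvd c" if "prime p" "p dvd \<mu>" for p
  proof -
    have "p dvd C ^ N" using that(2) by (simp add: \<mu>_def)
    then show ?thesis using C prime_dvd_power[OF that(1)] by blast
  qed
  have notin\<mu>: "\<not> int p dvd c" if p: "prime p" "p dvd N div \<mu>" for p
  proof
    assume "int p dvd c"
    then have pC: "p dvd C" by (simp only: C)
    define n where "n = multiplicity p N"
    have pn: "p ^ n dvd N" unfolding n_def by (rule multiplicity_dvd)
    have "n < 2 ^ n" by (rule less_exp)
    also have "2 ^ n \<le> p ^ n" using prime_ge_2_nat[OF p(1)] by (rule power_mono) simp
    also have "p ^ n \<le> N" using pn N by (rule dvd_imp_le)
    finally have "p ^ n dvd p ^ N" by (intro le_imp_power_dvd) simp
    also have "p ^ N dvd C ^ N" using pC by (rule dvd_power_same)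
    finally have "p ^ n dvd \<mu>" using pn by (simp add: \<mu>_def)
    then have "p ^ n * p dvd \<mu> * (N div \<mu>)" using p(2) by (rule mult_dvd_mono)
    then have "p ^ Suc n dvd N" unfolding \<mu>N by (simp only: power_Suc2)
    then have "Suc n \<le> n" unfolding n_def using N prime_gt_1_nat[OF p(1)] by (intro multiplicity_geI) auto
    then show False by simp
  qed
  have "coprime (int \<mu>) d"
  proof (rule coprime_int_by_primes)
    fix p assume p: "prime p" "p dvd \<mu>" "int p dvd d"
    then have "int p dvd c - d" using in\<mu> by (intro dvd_diff) auto
    then show False using cd prime_gt_1_nat[OF p(1)] by simp
  qed
  moreover have "coprime (int (N div \<mu>)) c"
    by (rule coprime_int_by_primes) (use notin\<mu> in blast)
  moreover have "coprime (int \<mu>) (int (N div \<mu>))"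
    by (rule coprime_int_by_primes) (use notin\<mu> in\<mu> in \<open>auto simp: \<mu>_def\<close>)
  then have "exact_divisor \<mu> N" using \<mu>N unfolding exact_divisor_def
    by (simp add: \<mu>_def)
  ultimately show thesis using that by blast
qed

text \<open>For the adapted \<open>\<mu>\<close>, the numbers y, z, t' are prime to
  \<open>\<mu>\<close> and x, w, t to its complement. This forces t and t' to be the two square-free
  parts, excludes cancelation, and splits the conditions on xy and zw into one for each
  entry.\<close>

lemma scaled_mat_imp_Gamma0_star:
  fixes x y z w :: int and t t' :: nat
  assumes det: "x * w * t - y * z * t' = 1" and Nt: "N = (square_part N)\<^sup>2 * (t * t')"
    and N: "N > 0" and \<sigma>: "\<sigma> > 0"
    and dvd: "int (square_part N) dvd \<sigma> * (x * y)" "int (square_part N) dvd \<sigma> * (z * w)"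
  shows "scaled_mat (square_part N) t t' x y z w \<in> Gamma0_star \<sigma> N" (is "?A \<in> _")
proof -
  obtain \<mu> where ex: "exact_divisor \<mu> N" and cop: "coprime (int \<mu>) (y * z * t')"
    "coprime (int (N div \<mu>)) (x * w * t)"
    using exists_adapted_exact_divisor[OF N det] .
  define s1 where "s1 = square_part \<mu>"
  define s2 where "s2 = square_part (N div \<mu>)"
  define t1 where "t1 = squarefree_part \<mu>"
  define t2 where "t2 = squarefree_part (N div \<mu>)"
  note parts = exact_divisor_parts[OF ex N]
  have s: "s1 > 0" "s2 > 0" "square_part N = s1 * s2" using parts by (auto simp: s1_def s2_def intro: Nat.gr0I)
  have s0: "square_part N > 0" "t > 0" using s N Nt by (auto intro: Nat.gr0I)
  have dvd\<mu>: "t1 dvd \<mu>" "s1 dvd \<mu>" "t2 dvd N div \<mu>" "s2 dvd N div \<mu>"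
    using squarefree_decompose[of \<mu>] squarefree_decompose[of "N div \<mu>"]
    unfolding s1_def s2_def t1_def t2_def power2_eq_square by (metis dvd_triv_left dvd_triv_right dvd_mult)+
  have c1: "coprime y (int k)" "coprime z (int k)" "coprime t' k" if "k dvd \<mu>" for k
  proof -
    have "coprime (y * z * t') (int k)" using cop(1) that
      by (meson coprime_commute coprime_divisors dvd_refl of_nat_dvd_iff)
    then show "coprime y (int k)" "coprime z (int k)" "coprime t' k" by auto
  qed
  have c2: "coprime x (int k)" "coprime w (int k)" "coprime t k" if "k dvd N div \<mu>" for k
  proof -
    have "coprime (x * w * t) (int k)" using cop(2) that
      by (meson coprime_commute coprime_divisors dvd_refl of_nat_dvd_iff)
    then show "coprime x (int k)" "coprime w (int k)" "coprime t k" by auto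
  qed
  have s12: "coprime s1 s2" using parts(4) dvd\<mu>(2,4) by (meson coprime_divisors)
  have "(square_part N)\<^sup>2 * (t * t') = (square_part N)\<^sup>2 * (t1 * t2)"
    using Nt parts(6) unfolding t1_def t2_def by simp
  then have tt: "t * t' = t1 * t2" using s0 N by (simp only: mult_cancel_left) simp
  have "t dvd t1" using c2(3)[OF dvd\<mu>(3)] tt by (metis coprime_dvd_mult_left_iff dvd_triv_left)
  moreover have "t1 dvd t" using c1(3)[OF dvd\<mu>(1)] tt
    by (metis coprime_commute coprime_dvd_mult_left_iff dvd_triv_left)
  ultimately have t: "t1 = t" by (rule dvd_antisym[rotated])
  then have t': "t2 = t'" using tt s0 by simp
  have SL: "?A \<in> carrier SL2R" using scaled_mat_SL2R[OF s0] det by simp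
  have P: "presentation N \<mu> (of_int x / of_nat s1) (of_int y / of_nat s2) (of_int z / of_nat s2)
      (of_int w / of_nat s1) ?A"
    unfolding presentation_def using ex presentation_scaled_mat[OF ex N, of x y z w]
    by (auto simp: frac_ints_def s1_def s2_def t[unfolded t1_def] t'[unfolded t2_def])
  have cf: "cancelation_free (of_int x / of_nat s1) (of_int y / of_nat s2) (of_int z / of_nat s2)
      (of_int w / of_nat s1)"
    unfolding cancelation_free_def using c1[OF dvd\<mu>(2)] c2[OF dvd\<mu>(4)] s12 s
    by (intro conjI no_cancel_divide) (simp_all add: coprime_commute)
  have ss: "int s1 dvd int (square_part N)" "int s2 dvd int (square_part N)" using s(3) by simp_all
  have cancel: "int k dvd \<sigma> * p" if "int k dvd \<sigma> * (p * q)" "coprime q (int k)" for p q :: int and k :: nat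
  proof -
    have "int k dvd (\<sigma> * p) * q" using that(1) by (simp only: mult.assoc)
    then show ?thesis using that(2) by (simp add: coprime_dvd_mult_left_iff coprime_commute)
  qed
  have "int s1 dvd \<sigma> * x" using cancel[OF dvd_trans[OF ss(1) dvd(1)]] c1[OF dvd\<mu>(2)] by blast
  moreover have "int s2 dvd \<sigma> * z" using cancel[OF dvd_trans[OF ss(2) dvd(2)]] c2[OF dvd\<mu>(4)] by blast
  moreover have "int s2 dvd \<sigma> * y" using cancel[of s2 y x] dvd_trans[OF ss(2) dvd(1)] c2[OF dvd\<mu>(4)]
    by (simp only: mult.commute)
  moreover have "int s1 dvd \<sigma> * w" using cancel[of s1 w z] dvd_trans[OF ss(1) dvd(2)] c1[OF dvd\<mu>(2)]
    by (simp only: mult.commute)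
  ultimately have "{of_int x / of_nat s1, of_int y / of_nat s2, of_int z / of_nat s2, of_int w / of_nat s1}
      \<subseteq> frac_ints \<sigma>"
    using s \<sigma> by (simp add: frac_ints_divide_iff)
  then show ?thesis unfolding Gamma0_star_def Gamma0_star_full_def using SL P cf by blast
qed

section \<open>The normalizer\<close>

lemma sqrt_rational_decomposition:
  fixes \<alpha> :: real
  assumes "\<alpha>\<^sup>2 \<in> \<int>" "\<alpha> \<noteq> 0"
  obtains \<kappa> :: real and \<tau> :: nat where "\<kappa> \<in> \<rat>" "\<kappa> \<noteq> 0" "squarefree \<tau>" "\<alpha> = \<kappa> * sqrt \<tau>"
proof -
  obtain k :: int where k: "\<alpha>\<^sup>2 = of_int k" using assms(1) by (auto elim: Ints_cases)
  have "k \<ge> 0" using k by (metis of_int_0_le_iff zero_le_power2)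
  then obtain n where n: "k = int n" by (metis nonneg_int_cases)
  define \<tau> where "\<tau> = squarefree_part n"
  have "n = \<tau> * (square_part n)\<^sup>2" unfolding \<tau>_def by (rule squarefree_decompose)
  then have "real n = \<tau> * (real (square_part n))\<^sup>2" by (metis of_nat_mult of_nat_power)
  then have "\<bar>\<alpha>\<bar> = sqrt (\<tau> * (real (square_part n))\<^sup>2)" using k n by (metis of_int_of_nat_eq real_sqrt_abs)
  also have "\<dots> = real (square_part n) * sqrt \<tau>" by (simp add: real_sqrt_mult)
  finally have "\<bar>\<alpha>\<bar> = real (square_part n) * sqrt \<tau>" .
  then have "\<alpha> = (sgn \<alpha> * real (square_part n)) * sqrt \<tau>"
    by (metis mult.assoc mult_sgn_abs)
  moreover have "sgn \<alpha> * real (square_part n) \<in> \<rat>" by (auto simp: sgn_real_def)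
  moreover have "sgn \<alpha> * real (square_part n) \<noteq> 0" using calculation(1) assms(2) by (metis mult_zero_left)
  ultimately show thesis using that[of "sgn \<alpha> * real (square_part n)" \<tau>] by (auto simp: \<tau>_def)
qed

text \<open>Multiplying by a nonzero entry of the first column makes the whole matrix rational, so
  all entries share one irrationality, the root of a square-free \<open>\<tau>\<close>. The
  integrality of squares then removes the denominators.\<close>

lemma integral_entries_imp_scaled_mat:
  fixes \<alpha> \<beta> \<gamma> \<delta> :: real
  assumes N: "N > 0" and det: "\<alpha> * \<delta> - \<beta> * \<gamma> = 1"
    and sq: "\<alpha>\<^sup>2 \<in> \<int>" "\<delta>\<^sup>2 \<in> \<int>" "N * \<beta>\<^sup>2 \<in> \<int>" "\<gamma>\<^sup>2 / N \<in> \<int>"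
    and pr: "\<alpha> * \<gamma> \<in> \<int>" "\<gamma> * \<delta> \<in> \<int>" "N * (\<alpha> * \<beta>) \<in> \<int>"
  obtains t t' :: nat and x y z w :: int
  where "mat2 \<alpha> \<beta> \<gamma> \<delta> = scaled_mat (square_part N) t t' x y z w"
    "x * w * t - y * z * t' = 1" "N = (square_part N)\<^sup>2 * (t * t')"
proof -
  have Ints_Rats: "a \<in> \<rat>" if "a \<in> \<int>" for a :: real using that by (auto elim: Ints_cases)
  have N0: "real N \<noteq> 0" using N by simp
  have \<alpha>\<beta>: "\<alpha> * \<beta> \<in> \<rat>"
  proof -
    have "\<alpha> * \<beta> = N * (\<alpha> * \<beta>) / N" using N0 by simp
    then show ?thesis using Ints_Rats[OF pr(3)] by (metis Rats_divide Rats_of_nat)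
  qed
  have \<gamma>2: "\<gamma>\<^sup>2 \<in> \<int>"
  proof -
    have "\<gamma>\<^sup>2 = real N * (\<gamma>\<^sup>2 / N)" using N0 by simp
    then show ?thesis using sq(4) by (metis Ints_mult Ints_of_nat)
  qed
  have \<alpha>\<delta>: "\<alpha> * \<delta> \<in> \<rat>"
  proof -
    have "(\<beta> * \<gamma>)\<^sup>2 = (N * \<beta>\<^sup>2) * (\<gamma>\<^sup>2 / N)" using N0 by (simp add: power_mult_distrib)
    moreover have "\<beta> * \<gamma> = \<alpha> * \<delta> - 1" using det by simp
    then have "(\<beta> * \<gamma>)\<^sup>2 = (\<alpha> * \<delta> - 1)\<^sup>2" by simp
    \<comment> \<open>Squaring \<open>\<beta>\<gamma> = \<alpha>\<delta> - 1\<close> leaves a linear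
      equation for \<open>\<alpha>\<delta>\<close>, because all the squares are known to be
      rational.\<close>
    ultimately have "\<alpha> * \<delta> = (1 + \<alpha>\<^sup>2 * \<delta>\<^sup>2 - (N * \<beta>\<^sup>2) * (\<gamma>\<^sup>2 / N)) / 2"
      by (simp add: power2_eq_square algebra_simps)
    moreover have "1 + \<alpha>\<^sup>2 * \<delta>\<^sup>2 - (N * \<beta>\<^sup>2) * (\<gamma>\<^sup>2 / N) \<in> \<rat>"
      using sq by (intro Rats_diff Rats_add Rats_mult Ints_Rats) auto
    ultimately show ?thesis by (metis Rats_divide Rats_number_of)
  qed
  have \<beta>\<gamma>: "\<beta> * \<gamma> \<in> \<rat>"
  proof -
    have "\<beta> * \<gamma> = \<alpha> * \<delta> - 1" using det by simp
    then show ?thesis using \<alpha>\<delta> by simp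
  qed
  have "\<exists>\<epsilon>. \<epsilon> \<noteq> 0 \<and> \<epsilon>\<^sup>2 \<in> \<int> \<and> \<alpha> * \<epsilon> \<in> \<rat> \<and> \<beta> * \<epsilon> \<in> \<rat> \<and> \<gamma> * \<epsilon> \<in> \<rat> \<and> \<delta> * \<epsilon> \<in> \<rat>"
  proof (cases "\<alpha> = 0")
    case False
    then show ?thesis using sq(1) \<alpha>\<beta> \<alpha>\<delta> Ints_Rats[OF pr(1)] Ints_Rats[OF sq(1)]
      by (intro exI[of _ \<alpha>]) (simp add: mult.commute power2_eq_square)
  next
    case True
    then have "\<gamma> \<noteq> 0" using det by auto
    then show ?thesis using \<gamma>2 \<beta>\<gamma> Ints_Rats[OF pr(1)] Ints_Rats[OF pr(2)] Ints_Rats[OF \<gamma>2]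
      by (intro exI[of _ \<gamma>]) (simp add: mult.commute power2_eq_square)
  qed
  then obtain \<epsilon> where \<epsilon>: "\<epsilon> \<noteq> 0" "\<epsilon>\<^sup>2 \<in> \<int>" "\<alpha> * \<epsilon> \<in> \<rat>" "\<beta> * \<epsilon> \<in> \<rat>" "\<gamma> * \<epsilon> \<in> \<rat>" "\<delta> * \<epsilon> \<in> \<rat>" by blast
  obtain \<kappa> :: real and \<tau> :: nat where \<kappa>: "\<kappa> \<in> \<rat>" "\<kappa> \<noteq> 0" and \<tau>: "squarefree \<tau>" and \<epsilon>_eq: "\<epsilon> = \<kappa> * sqrt \<tau>"
    using sqrt_rational_decomposition[OF \<epsilon>(2,1)] .
  have \<tau>0: "\<tau> > 0" using \<tau> by (auto intro: Nat.gr0I)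
  have rat: "\<exists>q\<in>\<rat>. E = q * sqrt \<tau>" if "E * \<epsilon> \<in> \<rat>" for E
  proof (rule bexI)
    have "E = (E * \<epsilon>) / \<epsilon>" using \<epsilon>(1) by simp
    also have "\<dots> = (E * \<epsilon>) / (\<kappa> * \<tau>) * sqrt \<tau>"
      using \<tau>0 \<kappa>(2) unfolding \<epsilon>_eq by (simp add: field_simps)
    finally show "E = (E * \<epsilon>) / (\<kappa> * \<tau>) * sqrt \<tau>" .
    show "(E * \<epsilon>) / (\<kappa> * \<tau>) \<in> \<rat>" by (rule Rats_divide[OF that Rats_mult[OF \<kappa>(1) Rats_of_nat]])
  qed
  obtain qa where qa: "qa \<in> \<rat>" "\<alpha> = qa * sqrt \<tau>" using rat[OF \<epsilon>(3)] by blast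
  obtain qb where qb: "qb \<in> \<rat>" "\<beta> = qb * sqrt \<tau>" using rat[OF \<epsilon>(4)] by blast
  obtain qc where qc: "qc \<in> \<rat>" "\<gamma> = qc * sqrt \<tau>" using rat[OF \<epsilon>(5)] by blast
  obtain qd where qd: "qd \<in> \<rat>" "\<delta> = qd * sqrt \<tau>" using rat[OF \<epsilon>(6)] by blast
  have square: "(q * sqrt \<tau>)\<^sup>2 = q\<^sup>2 * \<tau>" for q by (simp add: power_mult_distrib)
  have "qa \<in> \<int>" using sq(1) unfolding qa(2) square by (rule rational_times_sqrt_squarefree[OF qa(1) \<tau>])
  then obtain x where x: "qa = of_int x" by (auto elim: Ints_cases)
  have "qd \<in> \<int>" using sq(2) unfolding qd(2) square by (rule rational_times_sqrt_squarefree[OF qd(1) \<tau>])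
  then obtain w where w: "qd = of_int w" by (auto elim: Ints_cases)
  have "qc \<in> \<int>" using \<gamma>2 unfolding qc(2) square by (rule rational_times_sqrt_squarefree[OF qc(1) \<tau>])
  then obtain c where c: "qc = of_int c" by (auto elim: Ints_cases)
  have "N * (N * \<beta>\<^sup>2) \<in> \<int>" using Ints_mult[OF Ints_of_nat sq(3)] .
  also have "N * (N * \<beta>\<^sup>2) = (N * qb)\<^sup>2 * \<tau>" unfolding qb(2) square by (simp add: power2_eq_square)
  finally have "N * qb \<in> \<int>"
    by (rule rational_times_sqrt_squarefree[OF Rats_mult[OF Rats_of_nat qb(1)] \<tau>])
  then obtain b where b: "N * qb = of_int b" by (auto elim: Ints_cases)
  have cN: "int N dvd c\<^sup>2 * int \<tau>"
  proof -
    obtain k where "\<gamma>\<^sup>2 / N = of_int k" using sq(4) by (auto elim: Ints_cases)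
    then have "real_of_int (c\<^sup>2 * int \<tau>) / real N = of_int k" unfolding qc(2) square c by simp
    then show ?thesis using N by (rule of_int_divide_eq_imp_dvd)
  qed
  have bN: "int N dvd b\<^sup>2 * int \<tau>"
  proof -
    obtain k where k: "N * \<beta>\<^sup>2 = of_int k" using sq(3) by (auto elim: Ints_cases)
    have "real_of_int (b\<^sup>2 * int \<tau>) / real N = (N * qb)\<^sup>2 * \<tau> / N" unfolding b by simp
    also have "\<dots> = N * \<beta>\<^sup>2" unfolding qb(2) square using N0 by (simp add: power2_eq_square)
    finally show ?thesis unfolding k using N by (rule of_int_divide_eq_imp_dvd)
  qed
  define s where "s = square_part N"
  define u where "u = squarefree_part N"
  have Nsu: "N = s\<^sup>2 * u" unfolding s_def u_def by (metis squarefree_decompose mult.commute)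
  have u: "squarefree u" unfolding u_def by simp
  have s0: "s > 0" "u > 0" using N Nsu by (auto intro: Nat.gr0I)
  have reduce: "\<exists>a'. a = int s * a' \<and> int u dvd a'\<^sup>2 * int \<tau>" if "int N dvd a\<^sup>2 * int \<tau>" for a
  proof -
    have Nsu': "int N = (int s)\<^sup>2 * int u" by (subst Nsu) simp
    have ds: "(int s)\<^sup>2 dvd a\<^sup>2 * int \<tau>" using that unfolding Nsu' by (rule dvd_mult_left)
    have "int s dvd a" by (rule squarefree_scaled_dvd[OF \<tau> ds]) (use s0 in simp)
    then obtain a' where a': "a = int s * a'" by blast
    have "(int s)\<^sup>2 * int u dvd (int s)\<^sup>2 * (a'\<^sup>2 * int \<tau>)"
      using that unfolding Nsu' a' by (simp only: power_mult_distrib mult.assoc)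
    then show ?thesis using a' s0 by auto
  qed
  obtain c1 where c1: "c = int s * c1" "int u dvd c1\<^sup>2 * int \<tau>" using reduce[OF cN] by blast
  obtain b1 where b1: "b = int s * b1" "int u dvd b1\<^sup>2 * int \<tau>" using reduce[OF bN] by blast
  \<comment> \<open>The part of \<open>\<tau>\<close> shared with the square-free part of N. The
    cofactor \<open>\<rho>\<close> will divide both terms of the determinant, hence equal 1.\<close>
  define t where "t = gcd \<tau> u"
  have t0: "t > 0" using s0 by (simp add: t_def)
  obtain \<rho> where \<rho>: "\<tau> = t * \<rho>" unfolding t_def by (metis dvdE gcd_dvd1)
  obtain t' where t': "u = t * t'" unfolding t_def by (metis dvdE gcd_dvd2)
  have "t * gcd \<rho> t' = t" using \<rho> t' unfolding t_def by (metis gcd_mult_distrib_nat)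
  then have cop: "coprime \<rho> t'" using t0 by (simp add: coprime_iff_gcd_eq_1)
  have t'sf: "squarefree t'" using u unfolding t' by (rule squarefree_multD)
  have t'0: "t' > 0" using s0 t' by (auto intro: Nat.gr0I)
  have t'_dvd: "int t' dvd a" if "int u dvd a\<^sup>2 * int \<tau>" for a
  proof -
    have "int t * int t' dvd int t * (a\<^sup>2 * int \<rho>)" using that unfolding t' \<rho> by (simp only: of_nat_mult mult_ac)
    then have "int t' dvd a\<^sup>2 * int \<rho>" using t0 by simp
    then have "int t' dvd a\<^sup>2" using cop by (simp add: coprime_dvd_mult_left_iff coprime_commute)
    then show ?thesis by (rule squarefree_dvd_of_dvd_square[OF t'sf])
  qed
  obtain z where z: "c1 = int t' * z" using t'_dvd[OF c1(2)] by blast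
  obtain y where y: "b1 = int t' * y" using t'_dvd[OF b1(2)] by blast
  have sN: "real N = real s * real s * real t * real t'" unfolding Nsu t' by (simp add: power2_eq_square)
  have \<gamma>: "\<gamma> = z * s * t' * sqrt \<tau>" unfolding qc(2) c c1 z by simp
  have qb': "qb = y / (s * t)"
  proof -
    have "real N * qb = s * t' * y" unfolding b b1 y by simp
    then show ?thesis unfolding sN using s0 t0 t'0 by (simp add: field_simps)
  qed
  have "\<alpha> * \<delta> - \<beta> * \<gamma> = real_of_int x * of_int w * \<tau> - of_int y / (s * t) * (of_int z * s * t') * \<tau>"
    unfolding qa(2) x qd(2) w qb(2) qb' \<gamma> by (simp add: field_simps)
  also have "\<dots> = of_int (x * w * (t * \<rho>) - y * z * t' * \<rho>)"
    unfolding \<rho> using s0 t0 by (simp add: field_simps)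
  finally have "real_of_int (x * w * (t * \<rho>) - y * z * t' * \<rho>) = of_int 1" using det by simp
  then have eq: "x * w * (t * \<rho>) - y * z * t' * \<rho> = 1" by (simp only: of_int_eq_iff)
  have "int \<rho> dvd x * w * (t * \<rho>) - y * z * t' * \<rho>" by simp
  then have \<rho>1: "\<rho> = 1" unfolding eq by simp
  then have \<tau>t: "\<tau> = t" using \<rho> by simp
  show thesis
  proof (rule that)
    show "mat2 \<alpha> \<beta> \<gamma> \<delta> = scaled_mat (square_part N) t t' x y z w"
      unfolding scaled_mat_def mat2_eq_iff s_def[symmetric] \<gamma> qa(2) qb(2) qd(2) x w qb' \<tau>t
      using s0 t0 by (simp add: field_simps)
    show "x * w * t - y * z * t' = 1" using eq \<rho>1 by simp
    show "N = (square_part N)\<^sup>2 * (t * t')" unfolding s_def[symmetric] t'[symmetric] by (rule Nsu)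
  qed
qed

lemma normalizer_imp_scaled_mat:
  assumes N: "N > 0" and m: "m > 0" and A: "A \<in> normalizer SL2R (Gamma1_torsion m N)"
  obtains t t' :: nat and x y z w :: int
  where "A = scaled_mat (square_part N) t t' x y z w"
    "x * w * t - y * z * t' = 1" "N = (square_part N)\<^sup>2 * (t * t')"
proof -
  interpret group SL2R by (rule group_SL2R)
  obtain \<alpha> \<beta> \<gamma> \<delta> where A_eq: "A = mat2 \<alpha> \<beta> \<gamma> \<delta>" using mat2_eta by blast
  have norm: "A \<in> carrier SL2R" "\<And>h. h \<in> Gamma1_torsion m N \<Longrightarrow> A ** h ** inv\<^bsub>SL2R\<^esub> A \<in> Gamma1_torsion m N"
    "\<And>h. h \<in> Gamma1_torsion m N \<Longrightarrow> inv\<^bsub>SL2R\<^esub> A ** h ** A \<in> Gamma1_torsion m N"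
    using A unfolding normalizer_iff[OF Gamma1_torsion_subset[OF m]] by (auto simp: SL2R_def)
  have det: "\<alpha> * \<delta> - \<beta> * \<gamma> = 1" using norm(1) unfolding A_eq mat2_SL2R .
  have inv: "inv\<^bsub>SL2R\<^esub> A = mat2 \<delta> (- \<beta>) (- \<gamma>) \<alpha>" unfolding A_eq by (rule inv_mat2[OF det])
  have "mat2 1 1 0 1 \<in> Gamma1_torsion m N" unfolding Gamma1_torsion_iff[OF m]
    by (rule exI[of _ 1], rule exI[of _ 1], rule exI[of _ 0], rule exI[of _ 1]) simp
  note upper = norm(2)[OF this] norm(3)[OF this]
  have "mat2 1 0 N 1 \<in> Gamma1_torsion m N" unfolding Gamma1_torsion_iff[OF m]
    by (rule exI[of _ 1], rule exI[of _ 0], rule exI[of _ 1], rule exI[of _ 1]) simp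
  note lower = norm(2)[OF this] norm(3)[OF this]
  have entries: "a \<in> \<int> \<and> b \<in> \<int> \<and> c / N \<in> \<int> \<and> d \<in> \<int>" if "mat2 a b c d \<in> Gamma1_torsion m N" for a b c d
    using that N unfolding Gamma1_torsion_iff[OF m] mat2_eq_iff by auto
  \<comment> \<open>With the upper unipotent, A gives the conditions on the first column and its
    inverse those on \<open>\<delta>\<^sup>2\<close> and \<open>\<gamma>\<delta>\<close>; with the
    lower one they give those on \<open>\<beta>\<^sup>2\<close> and
    \<open>\<alpha>\<beta>\<close>.\<close>
  note ent = entries[OF upper(1)[unfolded inv, unfolded A_eq mat2_mult]]
    entries[OF upper(2)[unfolded inv, unfolded A_eq mat2_mult]]
    entries[OF lower(1)[unfolded inv, unfolded A_eq mat2_mult]]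
    entries[OF lower(2)[unfolded inv, unfolded A_eq mat2_mult]]
  have "\<alpha>\<^sup>2 \<in> \<int>" using ent(1) by (simp add: power2_eq_square algebra_simps)
  moreover have "\<gamma>\<^sup>2 / N \<in> \<int>" using ent(1) by (simp add: power2_eq_square algebra_simps)
  moreover have "\<delta>\<^sup>2 \<in> \<int>" using ent(2) by (simp add: power2_eq_square algebra_simps)
  moreover have "N * \<beta>\<^sup>2 \<in> \<int>" using ent(3) by (simp add: power2_eq_square algebra_simps)
  moreover have "\<alpha> * \<gamma> \<in> \<int>"
  proof -
    have "1 + \<alpha> * \<gamma> \<in> \<int>" using ent(1) det by (simp add: algebra_simps)
    then show ?thesis using Ints_diff[OF _ Ints_1] by fastforce
  qed
  moreover have "\<gamma> * \<delta> \<in> \<int>"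
  proof -
    have "1 + \<gamma> * \<delta> \<in> \<int>" using ent(2) det by (simp add: algebra_simps)
    then show ?thesis using Ints_diff[OF _ Ints_1] by fastforce
  qed
  moreover have "N * (\<alpha> * \<beta>) \<in> \<int>"
  proof -
    have "1 + N * (\<alpha> * \<beta>) \<in> \<int>" using ent(4) det by (simp add: algebra_simps)
    then show ?thesis using Ints_diff[OF _ Ints_1] by fastforce
  qed
  ultimately show thesis using integral_entries_imp_scaled_mat[OF N det] that unfolding A_eq by blast
qed

text \<open>Since \<open>sigma_level\<close> is rational, the existential also asserts that its
  value is a positive integer dividing \<open>square_part N\<close>, as the level of
  \<open>Gamma0_star\<close> should be.\<close>

theorem theorem3p8:
  fixes N m :: nat
  assumes "N > 0" and "m > 0" and "m dvd Carmichael N"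
  shows "\<exists>\<sigma> :: nat. of_nat \<sigma> = sigma_level N m \<and> \<sigma> > 0 \<and> \<sigma> dvd square_part N \<and>
           normalizer SL2R (Gamma1_torsion m N) = Gamma0_star \<sigma> N"
proof -
  define \<sigma> where "\<sigma> = (\<Prod>p\<in>level_primes N m. p ^ local_level N m p)"
  interpret torsion_level N m \<sigma>
    unfolding \<sigma>_def using assms(1,2) by (rule torsion_level_prod)
  have "normalizer SL2R (Gamma1_torsion m N) = Gamma0_star \<sigma> N"
  proof (intro equalityI subsetI)
    fix A assume A: "A \<in> normalizer SL2R (Gamma1_torsion m N)"
    obtain t t' :: nat and x y z w :: int where A_eq: "A = scaled_mat (square_part N) t t' x y z w"
      and det: "x * w * t - y * z * t' = 1" and Nt: "N = (square_part N)\<^sup>2 * (t * t')"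
      using normalizer_imp_scaled_mat[OF assms(1,2) A] .
    show "A \<in> Gamma0_star \<sigma> N"
      using scaled_mat_normalizes_imp[OF A[unfolded A_eq] det Nt]
        scaled_mat_imp_Gamma0_star[OF det Nt assms(1) \<sigma>] unfolding A_eq by blast
  next
    fix A assume "A \<in> Gamma0_star \<sigma> N"
    then show "A \<in> normalizer SL2R (Gamma1_torsion m N)"
      using Gamma0_star_imp_scaled_mat[OF _ assms(1) \<sigma>] scaled_mat_normalizes by metis
  qed
  then show ?thesis
    using sigma_level_eq[OF assms(1,2)] \<sigma> level_dvd unfolding \<sigma>_def[symmetric] by (intro exI[of _ \<sigma>]) simp
qed

end
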